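(* Let $l\ge1$ and $m\ge3$ be integers and let $G=C_{lm}(S)$ with $S=\{s\in\{1,\dots,\lfloor lm/2\rfloor\}: s=l\text{ or } l\nmid s\}$ (equivalently, the join of $l$ copies of the cycle $C_m$). Then (i) $\nu(G)=\lfloor m/3\rfloor$; (ii) $G$ is well-covered (respectively Buchsbaum) if and only if $m\in\{3,4,5,7\}$; (iii) $G$ is vertex decomposable (respectively shellable, Cohen–Macaulay, sequentially Cohen–Macaulay) if and only if either $l=1$ and $m\in\{3,5\}$, or $l\ge2$ and $m=3$; (iv) $G$ satisfies $S_2$ if and only if either $l=1$ and $m\in\{3,5,7\}$, or $l\ge2$ and $m=3$.
   Context: The circulant graph $C_n(S)$ ($S\subseteq\{1,\dots,\lfloor n/2\rfloor\}$) has vertex set $\{0,\dots,n-1\}$ with $\{a,b\}$ an edge iff $\min(|a-b|,n-|a-b|)\in S$. Fix a field $\mathbb{K}$. $\Delta_G$ is the independence complex of $G$. $G$ is well-covered if all maximal independent sets have the same cardinality. $\nu(G)$ is the maximum number of edges in an induced matching (pairwise disjoint edges such that the induced subgraph on their endpoints has exactly these edges). For a face $F$, $\mathrm{lk}(F)=\{H\in\Delta:H\cap F=\emptyset,H\cup F\in\Delta\}$, $\mathrm{del}(F)=\{H\in\Delta:H\cap F=\emptyset\}$. $G$ is Cohen–Macaulay if $\widetilde H_i(\mathrm{lk}_{\Delta_G}(F);\mathbb{K})=0$ for every face $F$ and $i<\dim\mathrm{lk}_{\Delta_G}(F)$; Buchsbaum if $G\setminus N_G[x]$ is Cohen–Macaulay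 for every vertex $x$; $S_2$ if $\mathrm{lk}_{\Delta_G}(F)$ is connected for every face $F$ with $\dim\mathrm{lk}_{\Delta_G}(F)\ge1$; sequentially Cohen–Macaulay if each pure $i$-th skeleton of $\Delta_G$ (generated by the $i$-dimensional faces) is Cohen–Macaulay. A pure complex is vertex decomposable if it is a simplex or has a vertex $x$ with $\mathrm{lk}(x)$, $\mathrm{del}(x)$ vertex decomposable; shellable if pure with a facet order $F_1<\dots<F_r$ such that for all $j<i$ there are $x\in F_i\setminus F_j$ and $k<i$ with $F_i\setminus F_k=\{x\}$. $G$ has a property when $\Delta_G$ does. *)

theory Defs
  imports Main
begin

section \<open>Graphs (vertex set V, symmetric edge relation E)\<close>

definition circ_dist :: "nat \<Rightarrow> nat \<Rightarrow> nat \<Rightarrow> nat" where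
  "circ_dist n a b = (let d = (if b \<le> a then a - b else b - a) in min d (n - d))"

definition circ_vertices :: "nat \<Rightarrow> nat set" where
  "circ_vertices n = {0..<n}"

definition circ_adj :: "nat \<Rightarrow> nat set \<Rightarrow> nat \<Rightarrow> nat \<Rightarrow> bool" where
  "circ_adj n S a b \<longleftrightarrow> a < n \<and> b < n \<and> circ_dist n a b \<in> S"

definition independent :: "('a \<Rightarrow> 'a \<Rightarrow> bool) \<Rightarrow> 'a set \<Rightarrow> bool" where
  "independent E I \<longleftrightarrow> (\<forall>a\<in>I. \<forall>b\<in>I. \<not> E a b)"

definition indep_complex :: "'a set \<Rightarrow> ('a \<Rightarrow> 'a \<Rightarrow> bool) \<Rightarrow> 'a set set" where
  "indep_complex V E = {F. F \<subseteq> V \<and> independent E F}"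

definition maximal_independent :: "'a set \<Rightarrow> ('a \<Rightarrow> 'a \<Rightarrow> bool) \<Rightarrow> 'a set \<Rightarrow> bool" where
  "maximal_independent V E I \<longleftrightarrow> I \<subseteq> V \<and> independent E I \<and>
     (\<forall>J. I \<subseteq> J \<and> J \<subseteq> V \<and> independent E J \<longrightarrow> J = I)"

definition well_covered :: "'a set \<Rightarrow> ('a \<Rightarrow> 'a \<Rightarrow> bool) \<Rightarrow> bool" where
  "well_covered V E \<longleftrightarrow> (\<forall>I J. maximal_independent V E I \<and> maximal_independent V E J
       \<longrightarrow> card I = card J)"

text \<open>Induced matching: a set of edges (2-element sets {a,b} with E a b, a,b in V),
  pairwise disjoint, such that no edge of G joins two different edges of M
  (so the induced subgraph on the endpoints has exactly the edges of M).\<close>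
definition induced_matching :: "'a set \<Rightarrow> ('a \<Rightarrow> 'a \<Rightarrow> bool) \<Rightarrow> 'a set set \<Rightarrow> bool" where
  "induced_matching V E M \<longleftrightarrow>
     (\<forall>e\<in>M. \<exists>a b. e = {a, b} \<and> a \<noteq> b \<and> a \<in> V \<and> b \<in> V \<and> E a b) \<and>
     (\<forall>e\<in>M. \<forall>e'\<in>M. e \<noteq> e' \<longrightarrow> e \<inter> e' = {} \<and> (\<forall>a\<in>e. \<forall>b\<in>e'. \<not> E a b))"

definition induced_matching_number :: "'a set \<Rightarrow> ('a \<Rightarrow> 'a \<Rightarrow> bool) \<Rightarrow> nat" where
  "induced_matching_number V E = Max {card M | M. induced_matching V E M}"

definition closed_nbhd :: "'a set \<Rightarrow> ('a \<Rightarrow> 'a \<Rightarrow> bool) \<Rightarrow> 'a \<Rightarrow> 'a set" where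
  "closed_nbhd V E x = insert x {y\<in>V. E x y}"

definition cdim :: "'a set set \<Rightarrow> int" where
  "cdim \<Delta> = Max {int (card F) | F. F \<in> \<Delta>} - 1"

definition link :: "'a set set \<Rightarrow> 'a set \<Rightarrow> 'a set set" where
  "link \<Delta> F = {H\<in>\<Delta>. H \<inter> F = {} \<and> H \<union> F \<in> \<Delta>}"

definition deletion :: "'a set set \<Rightarrow> 'a set \<Rightarrow> 'a set set" where
  "deletion \<Delta> F = {H\<in>\<Delta>. H \<inter> F = {}}"

definition faces_of_dim :: "'a set set \<Rightarrow> int \<Rightarrow> 'a set set" where
  "faces_of_dim \<Delta> i = {F\<in>\<Delta>. int (card F) = i + 1}"

text \<open>Simplicial chains with coefficients in the field 'k, oriented by the linear order
  on vertices; an i-chain is a function on i-faces (zero elsewhere). Augmented complex,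
  so that the homology computed is reduced homology.\<close>
definition is_chain :: "'a set set \<Rightarrow> int \<Rightarrow> ('a set \<Rightarrow> 'k::field) \<Rightarrow> bool" where
  "is_chain \<Delta> i c \<longleftrightarrow> (\<forall>F. F \<notin> faces_of_dim \<Delta> i \<longrightarrow> c F = 0)"

text \<open>Coefficient of the face G in the boundary of c:
  boundary of [v_0<...<v_i] is the sum of (-1)^k [.., v_k omitted, ..].\<close>
definition boundary :: "'a::linorder set set \<Rightarrow> ('a set \<Rightarrow> 'k::field) \<Rightarrow> 'a set \<Rightarrow> 'k" where
  "boundary \<Delta> c G = (\<Sum>v\<in>{v. v \<notin> G \<and> insert v G \<in> \<Delta>}.
       (- 1) ^ card {u\<in>G. u < v} * c (insert v G))"

definition reduced_homology_vanishes ::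
    "'k::field itself \<Rightarrow> 'a::linorder set set \<Rightarrow> int \<Rightarrow> bool" where
  "reduced_homology_vanishes K \<Delta> i \<longleftrightarrow>
     (\<forall>c :: 'a set \<Rightarrow> 'k. is_chain \<Delta> i c \<and> (\<forall>G\<in>faces_of_dim \<Delta> (i - 1). boundary \<Delta> c G = 0)
        \<longrightarrow> (\<exists>d :: 'a set \<Rightarrow> 'k. is_chain \<Delta> (i + 1) d \<and>
               (\<forall>F\<in>faces_of_dim \<Delta> i. boundary \<Delta> d F = c F)))"

definition complex_CM :: "'k::field itself \<Rightarrow> 'a::linorder set set \<Rightarrow> bool" where
  "complex_CM K \<Delta> \<longleftrightarrow>
     (\<forall>F\<in>\<Delta>. \<forall>i. i < cdim (link \<Delta> F) \<longrightarrow> reduced_homology_vanishes K (link \<Delta> F) i)"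

definition complex_connected :: "'a set set \<Rightarrow> bool" where
  "complex_connected \<Delta> \<longleftrightarrow>
     (\<forall>u\<in>\<Union>\<Delta>. \<forall>v\<in>\<Union>\<Delta>. (\<lambda>a b. {a, b} \<in> \<Delta>)\<^sup>*\<^sup>* u v)"

definition complex_S2 :: "'a set set \<Rightarrow> bool" where
  "complex_S2 \<Delta> \<longleftrightarrow> (\<forall>F\<in>\<Delta>. cdim (link \<Delta> F) \<ge> 1 \<longrightarrow> complex_connected (link \<Delta> F))"

definition pure_skeleton :: "'a set set \<Rightarrow> int \<Rightarrow> 'a set set" where
  "pure_skeleton \<Delta> i = {G. \<exists>F\<in>faces_of_dim \<Delta> i. G \<subseteq> F}"

definition complex_SCM :: "'k::field itself \<Rightarrow> 'a::linorder set set \<Rightarrow> bool" where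
  "complex_SCM K \<Delta> \<longleftrightarrow> (\<forall>i. complex_CM K (pure_skeleton \<Delta> i))"

definition facets :: "'a set set \<Rightarrow> 'a set set" where
  "facets \<Delta> = {F\<in>\<Delta>. \<forall>G\<in>\<Delta>. F \<subseteq> G \<longrightarrow> G = F}"

definition pure :: "'a set set \<Rightarrow> bool" where
  "pure \<Delta> \<longleftrightarrow> (\<forall>F\<in>facets \<Delta>. \<forall>G\<in>facets \<Delta>. card F = card G)"

definition is_simplex :: "'a set set \<Rightarrow> bool" where
  "is_simplex \<Delta> \<longleftrightarrow> (\<exists>V. finite V \<and> \<Delta> = Pow V)"

inductive vertex_decomposable :: "'a set set \<Rightarrow> bool" where
  simplex: "pure \<Delta> \<Longrightarrow> is_simplex \<Delta> \<Longrightarrow> vertex_decomposable \<Delta>"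
| shedding: "pure \<Delta> \<Longrightarrow> {x} \<in> \<Delta> \<Longrightarrow> vertex_decomposable (link \<Delta> {x})
     \<Longrightarrow> vertex_decomposable (deletion \<Delta> {x}) \<Longrightarrow> vertex_decomposable \<Delta>"

definition shellable :: "'a set set \<Rightarrow> bool" where
  "shellable \<Delta> \<longleftrightarrow> pure \<Delta> \<and>
     (\<exists>Fs. distinct Fs \<and> set Fs = facets \<Delta> \<and>
        (\<forall>i<length Fs. \<forall>j<i. \<exists>x\<in>Fs ! i - Fs ! j. \<exists>k<i. Fs ! i - Fs ! k = {x}))"

definition graph_CM :: "'k::field itself \<Rightarrow> 'a::linorder set \<Rightarrow> ('a \<Rightarrow> 'a \<Rightarrow> bool) \<Rightarrow> bool" where
  "graph_CM K V E \<longleftrightarrow> complex_CM K (indep_complex V E)"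

definition graph_Buchsbaum :: "'k::field itself \<Rightarrow> 'a::linorder set \<Rightarrow> ('a \<Rightarrow> 'a \<Rightarrow> bool) \<Rightarrow> bool" where
  "graph_Buchsbaum K V E \<longleftrightarrow> (\<forall>x\<in>V. graph_CM K (V - closed_nbhd V E x) E)"

definition graph_SCM :: "'k::field itself \<Rightarrow> 'a::linorder set \<Rightarrow> ('a \<Rightarrow> 'a \<Rightarrow> bool) \<Rightarrow> bool" where
  "graph_SCM K V E \<longleftrightarrow> complex_SCM K (indep_complex V E)"

definition graph_S2 :: "'a set \<Rightarrow> ('a \<Rightarrow> 'a \<Rightarrow> bool) \<Rightarrow> bool" where
  "graph_S2 V E \<longleftrightarrow> complex_S2 (indep_complex V E)"

definition graph_vd :: "'a set \<Rightarrow> ('a \<Rightarrow> 'a \<Rightarrow> bool) \<Rightarrow> bool" where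
  "graph_vd V E \<longleftrightarrow> vertex_decomposable (indep_complex V E)"

definition graph_shellable :: "'a set \<Rightarrow> ('a \<Rightarrow> 'a \<Rightarrow> bool) \<Rightarrow> bool" where
  "graph_shellable V E \<longleftrightarrow> shellable (indep_complex V E)"

end

theory Submission
  imports Defs
begin

text \<open>
  The graph is the join of \<open>l\<close> copies of the cycle on \<open>m\<close> vertices, the copies being the residue
  classes modulo \<open>l\<close>, so its independence complex is the disjoint union of \<open>l\<close> copies of that of
  the cycle.

  For \<open>m = 6\<close> and \<open>m \<ge> 8\<close> some independent set dominates all of a copy but a path on three vertices.
  Its link is an edge together with an isolated point, which rules out every property except
  sequential Cohen--Macaulayness. A join of at least two cycles with \<open>m \<ge> 4\<close> is disconnected of
  positive dimension, and so is the square.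

  The top-dimensional pure skeleton settles sequential Cohen--Macaulayness of a single cycle. For
  even \<open>m\<close> it consists of two disjoint simplices, the even and the odd vertices. For
  \<open>m = 2 * p + 1 \<ge> 7\<close> it is a band around the closed walk \<open>0, 2, \<dots>, 2 * p, 1, 3, \<dots>, 2 * p - 1, 0\<close>,
  which does not bound over any field because it pairs nontrivially with a cocycle.
\<close>

section \<open>Reduced homology in degrees zero and one\<close>

text \<open>Little homology is needed. Wherever Cohen--Macaulayness has to be proved, the complexes
  are graphs, and connectedness suffices. Where it has to be refuted, degree 0 does it, except for
  single odd cycles, which need degree 1. A class is always shown to be nonzero by pairing a cycle
  with a cocycle; the values are 1 or -1, so the argument is uniform in the field.

  The numbers 3, 4, 5, 7 are the \<open>m \<ge> 3\<close> with just one integer between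
  \<open>m / 3\<close> and \<open>m / 2\<close>. Domination and independence bound the size of a
  maximal independent set by these two quantities.

  The delicate case is the single 7-cycle. It is pure, and all its links of positive dimension are
  connected, so homology in degree 0 cannot tell it from the 5-cycle. Vertex decomposability and
  shellability are not linked to homology here: elsewhere they are refuted by purity and
  connectedness, and for the 7-cycle by separate combinatorial arguments.\<close>

definition finite_complex :: "'a set set \<Rightarrow> bool" where
  "finite_complex D \<longleftrightarrow> finite D \<and> (\<forall>F\<in>D. finite F) \<and> (\<forall>F\<in>D. \<forall>G. G \<subseteq> F \<longrightarrow> G \<in> D)"

lemma finite_complexD:
  assumes "finite_complex D"
  shows "finite D" "F \<in> D \<Longrightarrow> finite F" "F \<in> D \<Longrightarrow> G \<subseteq> F \<Longrightarrow> G \<in> D"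
  using assms unfolding finite_complex_def by auto

lemma finite_vertices: "finite_complex D \<Longrightarrow> finite (\<Union>D)"
  unfolding finite_complex_def by auto

lemma vertex_iff: "finite_complex D \<Longrightarrow> v \<in> \<Union>D \<longleftrightarrow> {v} \<in> D"
  unfolding finite_complex_def by auto

lemma cdim_ge:
  assumes "finite_complex D" "F \<in> D"
  shows "int (card F) - 1 \<le> cdim D"
proof -
  have "finite {int (card F) | F. F \<in> D}"
    using finite_complexD(1)[OF assms(1)] by simp
  moreover have "int (card F) \<in> {int (card F) | F. F \<in> D}" using assms(2) by auto
  ultimately show ?thesis unfolding cdim_def using Max_ge by fastforce
qed

lemma cdim_attained:
  assumes "finite_complex D" "D \<noteq> {}"
  obtains F where "F \<in> D" "cdim D = int (card F) - 1"
proof -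
  have "finite {int (card F) | F. F \<in> D}"
    using finite_complexD(1)[OF assms(1)] by simp
  moreover have "{int (card F) | F. F \<in> D} \<noteq> {}" using assms(2) by auto
  ultimately have "Max {int (card F) | F. F \<in> D} \<in> {int (card F) | F. F \<in> D}" by (rule Max_in)
  then show ?thesis using that unfolding cdim_def by auto
qed

lemma finite_complex_link: "finite_complex D \<Longrightarrow> finite_complex (link D F)"
  unfolding finite_complex_def link_def by (auto; meson Un_mono subset_refl)

lemma link_empty [simp]: "link D {} = D"
  unfolding link_def by auto

lemma link_link:
  assumes "finite_complex D" "F \<inter> G = {}"
  shows "link (link D F) G = link D (F \<union> G)"
proof -
  have dc: "\<And>F G. F \<in> D \<Longrightarrow> G \<subseteq> F \<Longrightarrow> G \<in> D" using finite_complexD(3)[OF assms(1)] .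
  have "H \<union> F \<in> D \<and> H \<union> G \<in> D" if "H \<union> (F \<union> G) \<in> D" for H
    using dc[OF that] by (meson Un_upper1 Un_upper2 le_sup_iff sup.coboundedI2)
  then show ?thesis using assms(2) unfolding link_def
    by (auto simp: Un_assoc Un_commute Un_left_commute)
qed

lemma empty_in_link: "F \<in> D \<Longrightarrow> finite_complex D \<Longrightarrow> {} \<in> link D F"
  unfolding link_def finite_complex_def by auto

lemma complex_CM_link:
  assumes "finite_complex D" "complex_CM K D" "F \<in> D"
  shows "complex_CM K (link D F)"
  unfolding complex_CM_def
proof (intro ballI)
  fix G assume G: "G \<in> link D F"
  then have "F \<inter> G = {}" "F \<union> G \<in> D" unfolding link_def by (auto simp: Un_commute)
  then show "\<forall>i<cdim (link (link D F) G). reduced_homology_vanishes K (link (link D F) G) i"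
    using assms link_link[OF assms(1)] unfolding complex_CM_def by auto
qed

text \<open>Adjointness of boundary and coboundary: both sides sum over the pairs of an
  \<open>i\<close>-face \<open>e\<close> and a vertex \<open>v\<close> that completes it to an
  \<open>(i + 1)\<close>-face \<open>t\<close>. The signs agree because \<open>v\<close> does not
  count itself.\<close>

lemma cochain_pairing:
  fixes D :: "'a::linorder set set" and d \<phi> :: "'a set \<Rightarrow> 'k::field"
  assumes D: "finite_complex D"
  shows "(\<Sum>e\<in>faces_of_dim D i. \<phi> e * boundary D d e) =
    (\<Sum>t\<in>faces_of_dim D (i + 1). d t * (\<Sum>v\<in>t. (- 1) ^ card {u\<in>t. u < v} * \<phi> (t - {v})))"
proof -
  let ?N = "\<lambda>e. {v. v \<notin> e \<and> insert v e \<in> D}"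
  have finN: "finite (?N e)" for e
    by (rule finite_subset[OF _ finite_vertices[OF D]]) auto
  have fin: "finite (faces_of_dim D j)" for j
    using finite_complexD(1)[OF D] unfolding faces_of_dim_def by simp
  have fine: "finite e" if "e \<in> faces_of_dim D j" for e j
    using that finite_complexD(2)[OF D] unfolding faces_of_dim_def by simp
  have "(\<Sum>e\<in>faces_of_dim D i. \<phi> e * boundary D d e)
      = (\<Sum>(e, v)\<in>Sigma (faces_of_dim D i) ?N.
          \<phi> e * ((- 1) ^ card {u\<in>e. u < v} * d (insert v e)))"
    unfolding boundary_def sum_distrib_left by (rule sum.Sigma) (use fin finN in auto)
  also have "\<dots> = (\<Sum>(t, v)\<in>Sigma (faces_of_dim D (i + 1)) (\<lambda>t. t).
          d t * ((- 1) ^ card {u\<in>t. u < v} * \<phi> (t - {v})))"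
  proof (rule sum.reindex_bij_witness[where i = "\<lambda>(t, v). (t - {v}, v)" and j = "\<lambda>(e, v). (insert v e, v)"],
      goal_cases)
    case (2 a)
    then obtain e v where a: "a = (e, v)" "e \<in> faces_of_dim D i" "v \<notin> e" "insert v e \<in> D" by auto
    then have "card (insert v e) = Suc (card e)" using fine[OF a(2)] by simp
    then show ?case using a by (simp add: faces_of_dim_def)
  next
    case (4 a)
    then obtain t v where "a = (t, v)" "t \<in> faces_of_dim D (i + 1)" "v \<in> t" by auto
    moreover then have "finite t" using fine by blast
    moreover then have "card (t - {v}) + 1 = card t"
      using \<open>v \<in> t\<close> by (metis Suc_eq_plus1 card_Suc_Diff1)
    moreover have "t - {v} \<in> D"
      using \<open>t \<in> _\<close> finite_complexD(3)[OF D] unfolding faces_of_dim_def by blast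
    ultimately show ?case by (auto simp: faces_of_dim_def insert_absorb)
  next
    case (5 a)
    then obtain e v where a: "a = (e, v)" "v \<notin> e" by auto
    then have "{u \<in> insert v e. u < v} = {u \<in> e. u < v}" by auto
    then show ?case using a by (simp add: algebra_simps)
  qed auto
  also have "\<dots> = (\<Sum>t\<in>faces_of_dim D (i + 1). \<Sum>v\<in>t.
          d t * ((- 1) ^ card {u\<in>t. u < v} * \<phi> (t - {v})))"
    by (rule sum.Sigma[symmetric]) (use fin fine in auto)
  finally show ?thesis by (simp add: sum_distrib_left)
qed

text \<open>A cocycle pairs to zero with every boundary, so a single nonzero pairing certifies that
  the cycle \<open>c\<close> does not bound.\<close>

lemma cocycle_obstruction:
  fixes D :: "'a::linorder set set" and c \<phi> :: "'a set \<Rightarrow> 'k::field" and K :: "'k itself"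
  assumes D: "finite_complex D"
    and cocycle: "\<And>t. t \<in> faces_of_dim D (i + 1) \<Longrightarrow>
      (\<Sum>v\<in>t. (- 1) ^ card {u\<in>t. u < v} * \<phi> (t - {v})) = 0"
    and chain: "is_chain D i c"
    and cycle: "\<And>G. G \<in> faces_of_dim D (i - 1) \<Longrightarrow> boundary D c G = 0"
    and pairing: "(\<Sum>e\<in>faces_of_dim D i. \<phi> e * c e) \<noteq> 0"
  shows "\<not> reduced_homology_vanishes K D i"
proof
  assume "reduced_homology_vanishes K D i"
  then obtain d :: "'a set \<Rightarrow> 'k" where "\<forall>F\<in>faces_of_dim D i. boundary D d F = c F"
    using chain cycle unfolding reduced_homology_vanishes_def by blast
  then have "(\<Sum>e\<in>faces_of_dim D i. \<phi> e * c e) = (\<Sum>e\<in>faces_of_dim D i. \<phi> e * boundary D d e)"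
    by simp
  also have "\<dots> = 0" unfolding cochain_pairing[OF D] using cocycle by simp
  finally show False using pairing by simp
qed

lemma faces_of_dim_0: "finite_complex D \<Longrightarrow> faces_of_dim D 0 = (\<lambda>v. {v}) ` \<Union>D"
  using vertex_iff[of D] by (auto simp: faces_of_dim_def card_1_singleton_iff image_iff)

lemma faces_of_dim_minus_1: "finite_complex D \<Longrightarrow> faces_of_dim D (- 1) \<subseteq> {{}}"
  by (auto simp: faces_of_dim_def finite_complex_def)

lemma boundary_empty:
  "finite_complex D \<Longrightarrow> boundary D c {} = (\<Sum>v\<in>\<Union>D. c {v})"
  by (simp add: boundary_def set_eq_iff vertex_iff[symmetric] del: Union_iff)

lemma sum_doubleton_signed:
  fixes f :: "'a::linorder \<Rightarrow> 'k::field"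
  assumes "a < b"
  shows "(\<Sum>v\<in>{a, b}. (- 1) ^ card {u\<in>{a, b}. u < v} * f v) = f a - f b"
proof -
  have s: "{u\<in>{a, b}. u < a} = {}" "{u\<in>{a, b}. u < b} = {a}" using assms by auto
  have "a \<notin> {b}" using assms by auto
  then have "(\<Sum>v\<in>{a, b}. (- 1) ^ card {u\<in>{a, b}. u < v} * f v)
    = (- 1) ^ card {u\<in>{a, b}. u < a} * f a + (- 1) ^ card {u\<in>{a, b}. u < b} * f b"
    by (subst sum.insert) simp_all
  then show ?thesis unfolding s by simp
qed

lemma card_2_linorder_obtain:
  assumes "card (e :: 'a::linorder set) = 2"
  obtains a b where "a < b" "e = {a, b}"
proof -
  obtain x y where "e = {x, y}" "x \<noteq> y" using assms by (auto simp: card_2_iff)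
  then show ?thesis using that by (metis insert_commute linorder_neqE)
qed

text \<open>The indicator of \<open>P\<close> is constant on edges, hence a 0-cocycle, and it takes
  the value 1 on the reduced cycle \<open>u - v\<close>.\<close>

lemma not_H0_if_separated:
  fixes D :: "'a::linorder set set" and K :: "'k::field itself"
  assumes D: "finite_complex D" and inv: "\<And>a b. {a, b} \<in> D \<Longrightarrow> P a = P b"
    and u: "u \<in> \<Union>D" and v: "v \<in> \<Union>D" and sep: "P u" "\<not> P v"
  shows "\<not> reduced_homology_vanishes K D 0"
proof -
  define c :: "'a set \<Rightarrow> 'k" where
    "c F = (if F = {u} then 1 else if F = {v} then - 1 else 0)" for F
  define \<phi> :: "'a set \<Rightarrow> 'k" where "\<phi> F = (if P (the_elem F) then 1 else 0)" for F
  have uv: "u \<noteq> v" using sep by auto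
  have fin: "finite (\<Union>D)" using finite_vertices[OF D] .
  have inj: "inj_on (\<lambda>v. {v}) (\<Union>D)" by auto
  have c_split: "(\<Sum>w\<in>\<Union>D. g w * c {w}) = g u - g v" for g :: "'a \<Rightarrow> 'k"
  proof -
    have "(\<Sum>w\<in>\<Union>D. g w * c {w}) = (\<Sum>w\<in>{u, v}. g w * c {w})"
      by (rule sum.mono_neutral_right) (use fin u v in \<open>auto simp: c_def\<close>)
    then show ?thesis using uv by (simp add: c_def)
  qed
  show ?thesis
  proof (rule cocycle_obstruction[OF D, where c = c and \<phi> = \<phi>])
    fix t assume "t \<in> faces_of_dim D (0 + 1)"
    then have "card t = 2" "t \<in> D" by (auto simp: faces_of_dim_def)
    then obtain a b where ab: "a < b" "t = {a, b}" by (elim card_2_linorder_obtain)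
    then have d: "t - {a} = {b}" "t - {b} = {a}" by auto
    have "(\<Sum>v\<in>t. (- 1) ^ card {u\<in>t. u < v} * \<phi> (t - {v})) = \<phi> (t - {a}) - \<phi> (t - {b})"
      unfolding ab(2) by (rule sum_doubleton_signed[OF ab(1)])
    also have "\<dots> = 0" unfolding d using inv[of a b] \<open>t \<in> D\<close> ab by (simp add: \<phi>_def)
    finally show "(\<Sum>v\<in>t. (- 1) ^ card {u\<in>t. u < v} * \<phi> (t - {v})) = 0" .
  next
    show "is_chain D 0 c" unfolding is_chain_def faces_of_dim_0[OF D] c_def using u v by auto
  next
    fix G assume "G \<in> faces_of_dim D (0 - 1)"
    then have "G = {}" using faces_of_dim_minus_1[OF D] by auto
    then show "boundary D c G = 0" using boundary_empty[OF D, of c] c_split[of "\<lambda>_. 1"] by simp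
  next
    have "(\<Sum>e\<in>faces_of_dim D 0. \<phi> e * c e) = (\<Sum>w\<in>\<Union>D. (if P w then 1 else 0) * c {w})"
      unfolding faces_of_dim_0[OF D] by (subst sum.reindex[OF inj]) (simp add: \<phi>_def)
    then show "(\<Sum>e\<in>faces_of_dim D 0. \<phi> e * c e) \<noteq> 0" using c_split[of "\<lambda>w. if P w then 1 else 0"] sep by simp
  qed
qed

lemma not_connected_if_separated:
  assumes inv: "\<And>a b. {a, b} \<in> D \<Longrightarrow> P a = P b"
    and u: "u \<in> \<Union>D" and v: "v \<in> \<Union>D" and sep: "P u" "\<not> P v"
  shows "\<not> complex_connected D"
proof
  assume "complex_connected D"
  then have "(\<lambda>a b. {a, b} \<in> D)\<^sup>*\<^sup>* u v" using u v unfolding complex_connected_def by blast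
  then have "P v" by (induction rule: rtranclp_induct) (use inv sep in auto)
  then show False using sep by simp
qed

text \<open>The face \<open>F\<close> makes the dimension positive, so that Cohen--Macaulayness
  demands vanishing in degree 0.\<close>

lemma not_CM_if_separated:
  fixes D :: "'a::linorder set set" and K :: "'k::field itself"
  assumes "finite_complex D" "\<And>a b. {a, b} \<in> D \<Longrightarrow> P a = P b"
    and "u \<in> \<Union>D" "v \<in> \<Union>D" "P u" "\<not> P v" and "F \<in> D" "card F \<ge> 2"
  shows "\<not> complex_CM K D"
proof
  assume "complex_CM K D"
  moreover have "{} \<in> D" using assms(1,7) unfolding finite_complex_def by blast
  moreover have "0 < cdim D" using cdim_ge[OF assms(1,7)] assms(8) by simp
  ultimately have "reduced_homology_vanishes K D 0" unfolding complex_CM_def by force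
  then show False using not_H0_if_separated[OF assms(1-6)] by blast
qed

lemma boundary_edge:
  fixes D :: "'a::linorder set set" and a :: "'k::field"
  assumes D: "finite_complex D" and e: "{y, z} \<in> D" "y < z"
  shows "boundary D (\<lambda>F. if F = {y, z} then a else 0) {w}
    = (if w = z then a else if w = y then - a else 0)"
proof -
  let ?N = "{v. v \<notin> {w} \<and> insert v {w} \<in> D}"
  let ?d = "\<lambda>F. if F = {y, z} then a else 0"
  have finN: "finite ?N" by (rule finite_subset[OF _ finite_vertices[OF D]]) auto
  have step: "boundary D ?d {w} = (\<Sum>v\<in>?N \<inter> {x}. (- 1) ^ card {u\<in>{w}. u < v} * ?d (insert v {w}))"
    if "\<And>v. v \<noteq> x \<Longrightarrow> insert v {w} \<noteq> {y, z}" for x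
    unfolding boundary_def by (rule sum.mono_neutral_right[OF finN]) (use that in auto)
  consider "w = z" | "w = y" | "w \<noteq> z" "w \<noteq> y" by blast
  then show ?thesis
  proof cases
    case 1
    have N: "?N \<inter> {y} = {y}" "{u\<in>{w}. u < y} = {}" using e 1 by auto
    have "insert v {w} \<noteq> {y, z}" if "v \<noteq> y" for v using that 1 e by auto
    then have "boundary D ?d {w} = (\<Sum>v\<in>{y}. (- 1) ^ card {u\<in>{w}. u < v} * ?d (insert v {w}))"
      using step[of y] unfolding N(1) by blast
    also have "\<dots> = (- 1) ^ card {u\<in>{w}. u < y} * ?d (insert y {w})" by simp
    also have "\<dots> = ?d (insert y {w})" unfolding N(2) by simp
    finally show ?thesis using 1 by simp
  next
    case 2
    have "?N \<inter> {z} = {z}" "{u\<in>{w}. u < z} = {w}" using e 2 by (auto simp: insert_commute)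
    moreover have "insert v {w} \<noteq> {y, z}" if "v \<noteq> z" for v using that 2 e by auto
    ultimately have "boundary D ?d {w} = - a" using step[of z] 2 e by (simp add: insert_commute)
    then show ?thesis using 2 e by auto
  next
    case 3
    then have "insert v {w} \<noteq> {y, z}" for v by auto
    then show ?thesis using 3 by (simp add: boundary_def)
  qed
qed

lemma boundary_sum:
  fixes d :: "'b \<Rightarrow> 'a::linorder set \<Rightarrow> 'k::field"
  shows "boundary D (\<lambda>F. \<Sum>x\<in>A. d x F) G = (\<Sum>x\<in>A. boundary D (d x) G)"
  unfolding boundary_def sum_distrib_left by (rule sum.swap)

lemma boundary_add:
  fixes d d' :: "'a::linorder set \<Rightarrow> 'k::field"
  shows "boundary D (\<lambda>F. d F + d' F) G = boundary D d G + boundary D d' G"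
  unfolding boundary_def by (simp add: algebra_simps sum.distrib)

text \<open>Telescoping along the path. The coefficient \<open>a\<close> is built in so that
  \<open>H0_if_connected\<close> can add such chains without rescaling them.\<close>

lemma path_boundary:
  fixes D :: "'a::linorder set set" and a :: "'k::field"
  assumes D: "finite_complex D" and path: "(\<lambda>a b. {a, b} \<in> D)\<^sup>*\<^sup>* u v"
  shows "\<exists>d. is_chain D 1 d \<and>
    (\<forall>w. boundary D d {w} = (if w = v then a else 0) - (if w = u then a else 0))"
  using path
proof (induction rule: rtranclp_induct)
  case base
  show ?case by (rule exI[of _ "\<lambda>_. 0"]) (simp add: is_chain_def boundary_def)
next
  case (step y z)
  then obtain d where d: "is_chain D 1 d"
    "\<And>w. boundary D d {w} = (if w = y then a else 0) - (if w = u then a else 0)" by blast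
  have face: "{y, z} \<in> faces_of_dim D 1" if "y \<noteq> z"
    using step.hyps(2) that by (simp add: faces_of_dim_def)
  \<comment> \<open>A step may stand still, since \<open>{y, y}\<close> is a vertex. Edges are
    oriented by the order of their vertices, so a descending step enters with the opposite
    sign.\<close>
  consider "y = z" | "y < z" | "z < y" by force
  then show ?case
  proof cases
    case 1
    then show ?thesis using d by auto
  next
    case 2
    show ?thesis
    proof (intro exI conjI allI)
      show "is_chain D 1 (\<lambda>F. d F + (if F = {y, z} then a else 0))"
        using d(1) face 2 by (auto simp: is_chain_def)
      show "boundary D (\<lambda>F. d F + (if F = {y, z} then a else 0)) {w}
        = (if w = z then a else 0) - (if w = u then a else 0)" for w
        unfolding boundary_add d(2) boundary_edge[OF D step.hyps(2) 2] using 2 by auto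
    qed
  next
    case 3
    have zy: "{z, y} \<in> D" using step.hyps(2) by (simp add: insert_commute)
    show ?thesis
    proof (intro exI conjI allI)
      show "is_chain D 1 (\<lambda>F. d F + (if F = {z, y} then - a else 0))"
        using d(1) face 3 by (auto simp: is_chain_def insert_commute)
      show "boundary D (\<lambda>F. d F + (if F = {z, y} then - a else 0)) {w}
        = (if w = z then a else 0) - (if w = u then a else 0)" for w
        unfolding boundary_add d(2) boundary_edge[OF D zy 3] using 3 by auto
    qed
  qed
qed

text \<open>Join a base point \<open>v0\<close> to every vertex \<open>v\<close> by a path weighted
  with the coefficient of \<open>v\<close>. What accumulates at \<open>v0\<close> is the sum of all
  coefficients up to sign, which is zero for a reduced cycle.\<close>

lemma H0_if_connected:
  fixes D :: "'a::linorder set set" and K :: "'k::field itself"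
  assumes D: "finite_complex D" and con: "complex_connected D" and ne: "\<Union>D \<noteq> {}"
  shows "reduced_homology_vanishes K D 0"
  unfolding reduced_homology_vanishes_def
proof (intro allI impI, elim conjE)
  fix c :: "'a set \<Rightarrow> 'k"
  assume cycle: "\<forall>G\<in>faces_of_dim D (0 - 1). boundary D c G = 0"
  obtain v0 where v0: "v0 \<in> \<Union>D" using ne by blast
  have "{} \<in> faces_of_dim D (0 - 1)" using v0 D by (auto simp: faces_of_dim_def finite_complex_def)
  then have c0: "(\<Sum>v\<in>\<Union>D. c {v}) = 0" using cycle boundary_empty[OF D] by metis
  have "\<exists>d. is_chain D 1 d \<and>
    (\<forall>w. boundary D d {w} = (if w = v then c {v} else 0) - (if w = v0 then c {v} else 0))"
    if "v \<in> \<Union>D" for v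
    using path_boundary[OF D] con v0 that unfolding complex_connected_def by blast
  then obtain d where d: "\<And>v. v \<in> \<Union>D \<Longrightarrow> is_chain D 1 (d v)"
    "\<And>v w. v \<in> \<Union>D \<Longrightarrow>
      boundary D (d v) {w} = (if w = v then c {v} else 0) - (if w = v0 then c {v} else 0)"
    by metis
  show "\<exists>d. is_chain D (0 + 1) d \<and> (\<forall>F\<in>faces_of_dim D 0. boundary D d F = c F)"
  proof (intro exI conjI ballI)
    show "is_chain D (0 + 1) (\<lambda>F. \<Sum>v\<in>\<Union>D. d v F)"
      using d(1) unfolding is_chain_def by (auto intro!: sum.neutral)
    fix F assume "F \<in> faces_of_dim D 0"
    then obtain w where w: "w \<in> \<Union>D" "F = {w}" unfolding faces_of_dim_0[OF D] by blast
    have "boundary D (\<lambda>F. \<Sum>v\<in>\<Union>D. d v F) {w}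
      = (\<Sum>v\<in>\<Union>D. (if w = v then c {v} else 0) - (if w = v0 then c {v} else 0))"
      unfolding boundary_sum by (rule sum.cong) (use d(2) in auto)
    also have "\<dots> = (\<Sum>v\<in>\<Union>D. (if w = v then c {v} else 0)) - (\<Sum>v\<in>\<Union>D. (if w = v0 then c {v} else 0))"
      by (rule sum_subtractf)
    also have "(\<Sum>v\<in>\<Union>D. (if w = v0 then c {v} else 0)) = 0" using c0 by (cases "w = v0") simp_all
    also have "(\<Sum>v\<in>\<Union>D. (if w = v then c {v} else 0)) = c {w}"
      using w(1) finite_vertices[OF D] by (simp del: Union_iff)
    finally have "boundary D (\<lambda>F. \<Sum>v\<in>\<Union>D. d v F) {w} = c {w}" by simp
    then show "boundary D (\<lambda>F. \<Sum>v\<in>\<Union>D. d v F) F = c F" using w by simp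
  qed
qed

text \<open>Any single vertex has the empty face as its boundary.\<close>

lemma H_minus_1_if_nonempty:
  fixes D :: "'a::linorder set set" and K :: "'k::field itself"
  assumes D: "finite_complex D" and v: "v \<in> \<Union>D"
  shows "reduced_homology_vanishes K D (- 1)"
  unfolding reduced_homology_vanishes_def
proof (intro allI impI)
  fix c :: "'a set \<Rightarrow> 'k"
  let ?d = "\<lambda>F. if F = {v} then c {} else 0"
  have "is_chain D (- 1 + 1) ?d" using v by (auto simp: is_chain_def faces_of_dim_0[OF D])
  moreover have "boundary D ?d {} = c {}"
    using v finite_vertices[OF D] by (simp add: boundary_empty[OF D] )
  ultimately show "\<exists>d. is_chain D (- 1 + 1) d \<and> (\<forall>F\<in>faces_of_dim D (- 1). boundary D d F = c F)"
    using faces_of_dim_minus_1[OF D] by blast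
qed

lemma H_below_minus_1:
  fixes D :: "'a::linorder set set" and K :: "'k::field itself"
  assumes "i < - 1"
  shows "reduced_homology_vanishes K D i"
proof -
  have "faces_of_dim D i = {}" using assms by (auto simp: faces_of_dim_def)
  moreover have "is_chain D (i + 1) (\<lambda>_. 0 :: 'k)" by (simp add: is_chain_def)
  ultimately show ?thesis unfolding reduced_homology_vanishes_def by blast
qed

lemma link_card_le:
  assumes D: "finite_complex D" and "\<And>G. G \<in> D \<Longrightarrow> card G \<le> n" and "H \<in> link D F"
  shows "card H + card F \<le> n"
proof -
  have H: "H \<inter> F = {}" "H \<union> F \<in> D" using assms(3) by (auto simp: link_def)
  then have "finite H" "finite F" using finite_complexD(2)[OF D] by blast+
  then show ?thesis using H assms(2)[OF H(2)] by (simp add: card_Un_disjoint)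
qed

text \<open>The link of a nonempty face consists at most of isolated points, where only negative
  degrees are tested. Degree 0 is tested for the empty face alone, and only if there is an
  edge.\<close>

lemma CM_if_connected_graph:
  fixes D :: "'a::linorder set set" and K :: "'k::field itself"
  assumes D: "finite_complex D" and le: "\<And>F. F \<in> D \<Longrightarrow> card F \<le> 2"
    and con: "\<And>F. F \<in> D \<Longrightarrow> card F = 2 \<Longrightarrow> complex_connected D"
  shows "complex_CM K D"
  unfolding complex_CM_def
proof (intro ballI allI impI)
  fix F i assume F: "F \<in> D" and i: "i < cdim (link D F)"
  let ?L = "link D F"
  have L: "finite_complex ?L" using finite_complex_link[OF D] .
  obtain H where H: "H \<in> ?L" "cdim ?L = int (card H) - 1"
    using cdim_attained[OF L] empty_in_link[OF F D] by blast
  have HF: "card H + card F \<le> 2" using link_card_le[OF D le H(1)] .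
  consider "i < - 1" | "i = - 1" | "i = 0" using i H(2) HF by linarith
  then show "reduced_homology_vanishes K ?L i"
  proof cases
    case 1
    then show ?thesis by (rule H_below_minus_1)
  next
    case 2
    then have "card H > 0" using i H(2) by simp
    then obtain v where "v \<in> H" by (metis card.empty equals0I less_irrefl)
    then have "v \<in> \<Union>?L" using H(1) by blast
    then show ?thesis using H_minus_1_if_nonempty[OF L] 2 by simp
  next
    case 3
    then have "card H = 2" "card F = 0" using i H(2) HF by linarith+
    then have "F = {}" using F finite_complexD(2)[OF D] by simp
    moreover then have "H \<in> D" using H by simp
    moreover have "H \<noteq> {}" using \<open>card H = 2\<close> by auto
    then have "\<Union>D \<noteq> {}" using \<open>H \<in> D\<close> by blast
    ultimately show ?thesis using H0_if_connected[OF D con] \<open>card H = 2\<close> 3 by simp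
  qed
qed

section \<open>Connectivity of vertex decomposable and shellable complexes\<close>

lemma facet_above:
  assumes "finite_complex D" "F \<in> D"
  obtains M where "M \<in> facets D" "F \<subseteq> M"
proof -
  have "finite {G\<in>D. F \<subseteq> G}" using finite_complexD(1)[OF assms(1)] by simp
  then obtain M where M: "M \<in> {G\<in>D. F \<subseteq> G}" "\<And>G. G \<in> {G\<in>D. F \<subseteq> G} \<Longrightarrow> M \<subseteq> G \<Longrightarrow> G = M"
    using finite_has_maximal[of "{G\<in>D. F \<subseteq> G}"] assms(2) by (metis (mono_tags, lifting) empty_iff mem_Collect_eq order_refl)
  have "M \<in> facets D" using M unfolding facets_def by auto
  then show ?thesis using that M(1) by blast
qed

lemma facetsD: "M \<in> facets D \<Longrightarrow> M \<in> D"
  unfolding facets_def by simp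

lemma pure_facet_card:
  assumes "finite_complex D" "pure D" "F \<in> D" "M \<in> facets D"
  shows "card F \<le> card M"
proof -
  obtain N where "N \<in> facets D" "F \<subseteq> N" using facet_above[OF assms(1,3)] .
  moreover then have "card N = card M" "finite N"
    using assms facetsD finite_complexD(2) unfolding pure_def by blast+
  ultimately show ?thesis using card_mono by metis
qed

lemma other_element:
  assumes "2 \<le> card A"
  obtains y where "y \<in> A" "y \<noteq> x"
proof -
  have "\<not> A \<subseteq> {x}" using assms card_mono[of "{x}" A] by auto
  then show ?thesis using that by blast
qed

lemma edge_rtranclp_commute:
  assumes "(\<lambda>a b. {a, b} \<in> D)\<^sup>*\<^sup>* u v"
  shows "(\<lambda>a b. {a, b} \<in> D)\<^sup>*\<^sup>* v u"
  using assms
proof (induction rule: rtranclp_induct)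
  case (step y z)
  then have "{z, y} \<in> D" by (simp add: insert_commute)
  then show ?case using step.IH by (rule converse_rtranclp_into_rtranclp)
qed simp

lemma complex_connectedI:
  assumes "\<And>v. v \<in> \<Union>D \<Longrightarrow> (\<lambda>a b. {a, b} \<in> D)\<^sup>*\<^sup>* u v"
  shows "complex_connected D"
  unfolding complex_connected_def
proof (intro ballI)
  fix v w assume "v \<in> \<Union>D" "w \<in> \<Union>D"
  from edge_rtranclp_commute[OF assms[OF this(1)]] assms[OF this(2)]
  show "(\<lambda>a b. {a, b} \<in> D)\<^sup>*\<^sup>* v w" by (rule rtranclp_trans)
qed

lemma finite_complex_deletion: "finite_complex D \<Longrightarrow> finite_complex (deletion D F)"
  unfolding finite_complex_def deletion_def by (simp, blast)

lemma vd_pure: "vertex_decomposable D \<Longrightarrow> pure D"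
  by (induction rule: vertex_decomposable.induct) auto

text \<open>A direct induction without homology. If some facet avoids \<open>x\<close>, the deletion
  is connected and a facet through \<open>x\<close> ties \<open>x\<close> to it. Otherwise every
  facet contains \<open>x\<close>, and the complex is a cone with apex \<open>x\<close>.\<close>

lemma vd_connected:
  assumes "vertex_decomposable D" "finite_complex D" "F \<in> D" "2 \<le> card F"
  shows "complex_connected D"
  using assms
proof (induction arbitrary: F rule: vertex_decomposable.induct)
  case (simplex D)
  then obtain W where "D = Pow W" unfolding is_simplex_def by blast
  then show ?case unfolding complex_connected_def by (auto intro!: r_into_rtranclp)
next
  case (shedding D x)
  have dc: "\<And>F G. F \<in> D \<Longrightarrow> G \<subseteq> F \<Longrightarrow> G \<in> D" using finite_complexD(3)[OF shedding.prems(1)] .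
  \<comment> \<open>Purity carries the lower bound from \<open>F\<close> to all facets, so the
    induction hypothesis applies to the deletion and \<open>x\<close> has a neighbour.\<close>
  have card_facet: "2 \<le> card M" if "M \<in> facets D" for M
    using pure_facet_card[OF shedding.prems(1) shedding.hyps(1) shedding.prems(2) that] shedding.prems(3)
    by simp
  show ?case
  proof (cases "\<exists>G\<in>facets D. x \<notin> G")
    case True
    then obtain G where G: "G \<in> facets D" "x \<notin> G" by blast
    let ?Dx = "deletion D {x}"
    have "G \<in> ?Dx" using G facetsD unfolding deletion_def by blast
    then have con: "complex_connected ?Dx"
      using shedding.IH(2) finite_complex_deletion[OF shedding.prems(1)] card_facet[OF G(1)] by blast
    obtain M where M: "M \<in> facets D" "x \<in> M" using facet_above[OF shedding.prems(1) shedding.hyps(2)] by blast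
    obtain y where y: "y \<in> M" "y \<noteq> x" using other_element[OF card_facet[OF M(1)]] .
    have xy: "{y, x} \<in> D" using dc[OF facetsD[OF M(1)], of "{y, x}"] M(2) y(1) by blast
    have V: "v \<in> \<Union>?Dx" if "v \<in> \<Union>D" "v \<noteq> x" for v
    proof -
      have "{v} \<in> D" using that dc by blast
      then have "{v} \<in> ?Dx" using that(2) unfolding deletion_def by blast
      then show ?thesis by blast
    qed
    have mono: "(\<lambda>a b. {a, b} \<in> ?Dx)\<^sup>*\<^sup>* u v \<Longrightarrow> (\<lambda>a b. {a, b} \<in> D)\<^sup>*\<^sup>* u v" for u v
      by (erule rtranclp_mono[THEN predicate2D, rotated]) (auto simp: deletion_def)
    show ?thesis
    proof (rule complex_connectedI[where u = y])
      fix v assume v: "v \<in> \<Union>D"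
      show "(\<lambda>a b. {a, b} \<in> D)\<^sup>*\<^sup>* y v"
      proof (cases "v = x")
        case True
        then show ?thesis using xy by (auto intro: r_into_rtranclp)
      next
        case False
        have "y \<in> \<Union>D" using xy by blast
        then show ?thesis using con V[OF v False] V[OF _ y(2)] mono unfolding complex_connected_def by blast
      qed
    qed
  next
    case False
    show ?thesis
    proof (rule complex_connectedI[where u = x])
      fix v assume "v \<in> \<Union>D"
      then obtain H where "H \<in> D" "v \<in> H" by blast
      then obtain M where M: "M \<in> facets D" "v \<in> M" using facet_above[OF shedding.prems(1)] by blast
      then have "{x, v} \<in> D" using False dc[OF facetsD[OF M(1)], of "{x, v}"] by blast
      then show "(\<lambda>a b. {a, b} \<in> D)\<^sup>*\<^sup>* x v" by (rule r_into_rtranclp)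
    qed
  qed
qed

text \<open>Every facet after the first has all but one of its vertices in some earlier facet. As it
  has at least two, the two facets meet.\<close>

lemma shellable_connected:
  assumes "shellable D" "finite_complex D" "F \<in> D" "2 \<le> card F"
  shows "complex_connected D"
proof -
  have dc: "\<And>F G. F \<in> D \<Longrightarrow> G \<subseteq> F \<Longrightarrow> G \<in> D" using finite_complexD(3)[OF assms(2)] .
  obtain Fs where pure: "pure D" and Fs: "set Fs = facets D"
    and shell: "\<And>i j. i < length Fs \<Longrightarrow> j < i \<Longrightarrow>
      \<exists>x\<in>Fs ! i - Fs ! j. \<exists>k<i. Fs ! i - Fs ! k = {x}"
    using assms(1) unfolding shellable_def by blast
  have fac: "Fs ! i \<in> facets D" if "i < length Fs" for i using nth_mem[OF that] Fs by simp
  have card_facet: "2 \<le> card (Fs ! i)" if "i < length Fs" for i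
    using pure_facet_card[OF assms(2) pure assms(3) fac[OF that]] assms(4) by simp
  have edge: "{u, v} \<in> D" if "i < length Fs" "u \<in> Fs ! i" "v \<in> Fs ! i" for i u v
    using dc[OF facetsD[OF fac[OF that(1)]], of "{u, v}"] that by blast
  obtain M where "M \<in> facets D" using facet_above[OF assms(2,3)] by blast
  then have len: "0 < length Fs" using Fs by (metis length_pos_if_in_set)
  obtain u where u: "u \<in> Fs ! 0" using other_element[OF card_facet[OF len]] by blast
  have reach: "\<forall>v\<in>Fs ! i. (\<lambda>a b. {a, b} \<in> D)\<^sup>*\<^sup>* u v" if "i < length Fs" for i
    using that
  proof (induction i rule: less_induct)
    case (less i)
    show ?case
    proof (cases "i = 0")
      case True
      then show ?thesis using edge[OF len u] by (auto intro: r_into_rtranclp)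
    next
      case False
      then obtain x k where k: "k < i" "Fs ! i - Fs ! k = {x}" using shell[OF less.prems, of 0] by auto
      obtain y where y: "y \<in> Fs ! i" "y \<noteq> x" using other_element[OF card_facet[OF less.prems]] .
      then have "y \<in> Fs ! k" using k(2) by blast
      then have "(\<lambda>a b. {a, b} \<in> D)\<^sup>*\<^sup>* u y" using less k(1) by auto
      then show ?thesis using edge[OF less.prems y(1)] by (auto intro: rtranclp.rtrancl_into_rtrancl)
    qed
  qed
  show ?thesis
  proof (rule complex_connectedI[where u = u])
    fix v assume "v \<in> \<Union>D"
    then obtain H where "H \<in> D" "v \<in> H" by blast
    then obtain M where "M \<in> facets D" "v \<in> M" using facet_above[OF assms(2)] by blast
    then obtain i where "i < length Fs" "v \<in> Fs ! i" using Fs by (metis in_set_conv_nth)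
    then show "(\<lambda>a b. {a, b} \<in> D)\<^sup>*\<^sup>* u v" using reach by blast
  qed
qed

section \<open>Independence complexes and maximal independent sets\<close>

lemma finite_complex_indep_complex:
  assumes "finite V"
  shows "finite_complex (indep_complex V E)"
proof -
  have "indep_complex V E \<subseteq> Pow V" unfolding indep_complex_def by auto
  then have "finite (indep_complex V E)" using assms finite_subset by blast
  moreover have "finite F" if "F \<in> indep_complex V E" for F
    using that assms finite_subset unfolding indep_complex_def by blast
  moreover have "G \<in> indep_complex V E" if "F \<in> indep_complex V E" "G \<subseteq> F" for F G
    using that unfolding indep_complex_def independent_def by blast
  ultimately show ?thesis unfolding finite_complex_def by blast
qed

lemma facets_indep_complex: "facets (indep_complex V E) = {F. maximal_independent V E F}"
  unfolding facets_def indep_complex_def maximal_independent_def by auto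

lemma pure_indep_complex: "pure (indep_complex V E) \<longleftrightarrow> well_covered V E"
  unfolding pure_def well_covered_def facets_indep_complex by blast

lemma deletion_indep_complex: "deletion (indep_complex V E) {x} = indep_complex (V - {x}) E"
  unfolding deletion_def indep_complex_def by auto

lemma link_indep_complex:
  assumes "symp E" "irreflp E" "x \<in> V"
  shows "link (indep_complex V E) {x} = indep_complex (V - closed_nbhd V E x) E"
  using assms(3) sympD[OF assms(1)] irreflpD[OF assms(2)]
  unfolding link_def indep_complex_def closed_nbhd_def independent_def by (auto; blast)

lemma graph_Buchsbaum_iff:
  assumes "symp E" "irreflp E"
  shows "graph_Buchsbaum K V E \<longleftrightarrow> (\<forall>x\<in>V. complex_CM K (link (indep_complex V E) {x}))"
  unfolding graph_Buchsbaum_def graph_CM_def using link_indep_complex[OF assms] by auto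

lemma maximal_independent_iff:
  assumes "symp E" "irreflp E"
  shows "maximal_independent V E I \<longleftrightarrow>
    I \<subseteq> V \<and> independent E I \<and> (\<forall>y\<in>V. y \<in> I \<or> (\<exists>x\<in>I. E x y))"
proof
  assume max: "maximal_independent V E I"
  have "y \<in> I \<or> (\<exists>x\<in>I. E x y)" if "y \<in> V" for y
  proof (rule ccontr)
    assume "\<not> ?thesis"
    then have "independent E (insert y I)" "y \<notin> I"
      using max sympD[OF assms(1)] irreflpD[OF assms(2)]
      unfolding maximal_independent_def independent_def by auto
    then show False using max that unfolding maximal_independent_def by blast
  qed
  then show "I \<subseteq> V \<and> independent E I \<and> (\<forall>y\<in>V. y \<in> I \<or> (\<exists>x\<in>I. E x y))"
    using max unfolding maximal_independent_def by blast
next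
  assume "I \<subseteq> V \<and> independent E I \<and> (\<forall>y\<in>V. y \<in> I \<or> (\<exists>x\<in>I. E x y))"
  then show "maximal_independent V E I"
    unfolding maximal_independent_def independent_def by blast
qed

section \<open>Joins of cycles\<close>

definition cyc_indep :: "nat \<Rightarrow> nat set \<Rightarrow> bool" where
  "cyc_indep m I \<longleftrightarrow> I \<subseteq> {..<m} \<and> (\<forall>i\<in>I. Suc i mod m \<notin> I)"

text \<open>The last disjunct is the predecessor of \<open>i\<close>, phrased through its successor
  to avoid subtraction modulo \<open>m\<close>.\<close>

definition cyc_dominating :: "nat \<Rightarrow> nat set \<Rightarrow> bool" where
  "cyc_dominating m I \<longleftrightarrow> (\<forall>i<m. i \<in> I \<or> Suc i mod m \<in> I \<or> (\<exists>j\<in>I. Suc j mod m = i))"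

lemma mod_add_left_cancel_nat: "(k + i) mod m = (k + j) mod m \<longleftrightarrow> i mod m = j mod (m :: nat)"
  by (simp add: nat_mod_eq_iff)

lemma inj_on_Suc_mod: "inj_on (\<lambda>i. Suc i mod m) {..<m}"
  using mod_add_left_cancel_nat[of 1] by (auto simp: inj_on_def)

lemma Suc_mod_cases: "i < m \<Longrightarrow> Suc i mod m = (if Suc i = m then 0 else Suc i)"
  by auto

text \<open>\<open>I\<close> and its translate by one are disjoint and equally large. The exact
  number of vertices missed by both, and not only \<open>2 * card I \<le> m\<close>, is what the
  extremal sets below require.\<close>

lemma cyc_indep_card:
  assumes "cyc_indep m I"
  shows "card ({..<m} - (I \<union> (\<lambda>i. Suc i mod m) ` I)) + 2 * card I = m"
proof -
  let ?S = "(\<lambda>i. Suc i mod m) ` I"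
  have sub: "I \<subseteq> {..<m}" and disj: "I \<inter> ?S = {}" using assms unfolding cyc_indep_def by auto
  then have fin: "finite I" using finite_subset by blast
  have "I \<union> ?S \<subseteq> {..<m}" using sub by (auto intro!: mod_less_divisor)
  then have "card ({..<m} - (I \<union> ?S)) + card (I \<union> ?S) = m"
    using card_Diff_subset[of "I \<union> ?S" "{..<m}"] card_mono[of "{..<m}" "I \<union> ?S"] fin by simp
  moreover have "card ?S = card I" by (rule card_image[OF inj_on_subset[OF inj_on_Suc_mod sub]])
  ultimately show ?thesis using card_Un_disjoint[OF fin _ disj] fin by simp
qed

text \<open>Each element accounts for itself and its two neighbours.\<close>

lemma cyc_dominating_card:
  assumes "cyc_dominating m I" "I \<subseteq> {..<m}"
  shows "m \<le> 3 * card I"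
proof -
  let ?S = "(\<lambda>i. Suc i mod m) ` I" and ?P = "{i\<in>{..<m}. Suc i mod m \<in> I}"
  have fin: "finite I" using assms(2) finite_subset by blast
  have "card ?P \<le> card I"
    by (rule card_inj_on_le[of "\<lambda>i. Suc i mod m"]) (auto intro: fin inj_on_subset[OF inj_on_Suc_mod])
  moreover have "card ?S \<le> card I" by (rule card_image_le[OF fin])
  moreover have "card (I \<union> ?P \<union> ?S) \<le> card I + card ?P + card ?S"
    by (meson card_Un_le le_trans add_mono order_refl)
  moreover have "{..<m} \<subseteq> I \<union> ?P \<union> ?S" using assms(1) unfolding cyc_dominating_def by auto
  then have "card {..<m} \<le> card (I \<union> ?P \<union> ?S)" by (rule card_mono[rotated]) (use fin in auto)
  ultimately show ?thesis by simp
qed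

locale cycle_join =
  fixes l m :: nat
  assumes l_pos: "1 \<le> l" and m_ge_3: "3 \<le> m"
begin

text \<open>The join in coordinates: \<open>a mod l\<close> is the copy and \<open>a div l\<close>
  the position on its cycle. The lemma \<open>circ_adj_eq_adj\<close> identifies this with the
  circulant adjacency.\<close>

definition adj :: "nat \<Rightarrow> nat \<Rightarrow> bool" where
  "adj a b \<longleftrightarrow> a < l * m \<and> b < l * m \<and>
    (a mod l \<noteq> b mod l \<or> Suc (a div l) mod m = b div l \<or> Suc (b div l) mod m = a div l)"

definition \<Delta> :: "nat set set" where
  "\<Delta> = indep_complex {..<l * m} adj"

text \<open>Vertex number \<open>i mod m\<close> of the \<open>r\<close>-th copy of the cycle.\<close>

definition pt :: "nat \<Rightarrow> nat \<Rightarrow> nat" where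
  "pt r i = (i mod m) * l + r"

lemma symp_adj: "symp adj"
  unfolding adj_def by (rule sympI) auto

lemma div_less_m: "a < l * m \<Longrightarrow> a div l < m"
  by (simp add: less_mult_imp_div_less mult.commute)

lemma Suc_mod_neq: "i < m \<Longrightarrow> Suc i mod m \<noteq> i"
  using m_ge_3 by (auto simp: Suc_mod_cases)

lemma irreflp_adj: "irreflp adj"
  by (rule irreflpI) (use Suc_mod_neq div_less_m in \<open>auto simp: adj_def\<close>)

lemma finite_complex_\<Delta>: "finite_complex \<Delta>"
  unfolding \<Delta>_def by (rule finite_complex_indep_complex) simp

lemma pt_mod: "r < l \<Longrightarrow> pt r i mod l = r" and pt_div: "r < l \<Longrightarrow> pt r i div l = i mod m"
  unfolding pt_def by simp_all

lemma pt_less: assumes "r < l" shows "pt r i < l * m"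
proof -
  have "Suc (i mod m) \<le> m" using m_ge_3 by (simp add: Suc_leI)
  then have "Suc (i mod m) * l \<le> m * l" by (rule mult_le_mono1)
  then show ?thesis using assms unfolding pt_def by (simp add: mult.commute)
qed

lemma pt_eq_iff: "r < l \<Longrightarrow> s < l \<Longrightarrow> pt r i = pt s j \<longleftrightarrow> r = s \<and> i mod m = j mod m"
  using pt_mod pt_div by (metis pt_def)

lemma pt_surj: "a < l * m \<Longrightarrow> a = pt (a mod l) (a div l)"
  using div_less_m unfolding pt_def by simp

lemma adj_pt: "r < l \<Longrightarrow> s < l \<Longrightarrow>
  adj (pt r i) (pt s j) \<longleftrightarrow> r \<noteq> s \<or> Suc i mod m = j mod m \<or> Suc j mod m = i mod m"
  unfolding adj_def using pt_less by (auto simp: pt_mod pt_div mod_Suc_eq)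

lemma adj_pt_add: "r < l \<Longrightarrow>
  adj (pt r (k + i)) (pt r (k + j)) \<longleftrightarrow> Suc i mod m = j mod m \<or> Suc j mod m = i mod m"
  using mod_add_left_cancel_nat[of k "Suc i" m j] mod_add_left_cancel_nat[of k "Suc j" m i]
  by (simp add: adj_pt)

lemma inj_on_pt: "r < l \<Longrightarrow> inj_on (\<lambda>i. pt r (k + i)) {..<m}"
  by (auto simp: inj_on_def pt_eq_iff mod_add_left_cancel_nat)

text \<open>Coordinates on a copy with origin at position \<open>k\<close>. They allow later
  arguments to rotate a given vertex to coordinate 0.\<close>

lemma pt_surj_add:
  assumes "a < l * m" "a mod l = r" "r < l"
  obtains i where "i < m" "a = pt r (k + i)"
proof -
  \<comment> \<open>This is \<open>a div l - k\<close> modulo \<open>m\<close>, with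
    \<open>m - k mod m\<close> standing in for \<open>- k\<close>.\<close>
  define i where "i = (a div l + (m - k mod m)) mod m"
  have "(k + i) mod m = (k mod m + (a div l + (m - k mod m))) mod m"
    unfolding i_def by (simp add: mod_add_left_eq mod_add_right_eq)
  also have "k mod m + (a div l + (m - k mod m)) = a div l + m"
    using m_ge_3 mod_less_divisor[of m k] by linarith
  finally have "(k + i) mod m = a div l mod m" by simp
  then have "a = pt r (k + i)" using pt_surj[OF assms(1)] assms(2) by (simp add: pt_def)
  moreover have "i < m" unfolding i_def using m_ge_3 by simp
  ultimately show ?thesis using that by blast
qed

lemma indep_pt:
  assumes "r < l" "I \<subseteq> {..<m}"
  shows "(\<lambda>i. pt r (k + i)) ` I \<in> \<Delta> \<longleftrightarrow> cyc_indep m I"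
proof -
  have lt: "i < m" if "i \<in> I" for i using assms(2) that by auto
  then have "independent adj ((\<lambda>i. pt r (k + i)) ` I) \<longleftrightarrow>
    (\<forall>i\<in>I. \<forall>j\<in>I. \<not> (Suc i mod m = j \<or> Suc j mod m = i))"
    unfolding independent_def using adj_pt_add[OF assms(1)] by simp
  also have "\<dots> \<longleftrightarrow> cyc_indep m I" using assms(2) unfolding cyc_indep_def by auto
  finally show ?thesis unfolding \<Delta>_def indep_complex_def using pt_less[OF assms(1)] by auto
qed

lemma same_copy: "F \<in> \<Delta> \<Longrightarrow> a \<in> F \<Longrightarrow> b \<in> F \<Longrightarrow> a mod l = b mod l"
  unfolding \<Delta>_def indep_complex_def independent_def adj_def by blast

lemma face_less: "F \<in> \<Delta> \<Longrightarrow> a \<in> F \<Longrightarrow> a < l * m"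
  unfolding \<Delta>_def indep_complex_def by blast

text \<open>Vertices of different copies are adjacent, so one vertex fixes the copy of the whole
  face.\<close>

lemma face_obtain:
  assumes "F \<in> \<Delta>" "pt r k \<in> F" "r < l"
  obtains I where "cyc_indep m I" "0 \<in> I" "F = (\<lambda>i. pt r (k + i)) ` I"
proof -
  define I where "I = {i\<in>{..<m}. pt r (k + i) \<in> F}"
  have F: "F = (\<lambda>i. pt r (k + i)) ` I"
  proof (intro equalityI subsetI)
    fix a assume a: "a \<in> F"
    then have "a mod l = r" using same_copy[OF assms(1) a assms(2)] pt_mod[OF assms(3)] by simp
    then obtain i where "i < m" "a = pt r (k + i)"
      using pt_surj_add[OF face_less[OF assms(1) a] _ assms(3)] by blast
    then show "a \<in> (\<lambda>i. pt r (k + i)) ` I" using a unfolding I_def by blast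
  qed (auto simp: I_def)
  moreover have "cyc_indep m I" using indep_pt[OF assms(3), of I k] F assms(1) unfolding I_def by auto
  moreover have "0 \<in> I" unfolding I_def using assms(2) m_ge_3 by simp
  ultimately show ?thesis using that by blast
qed

lemma face_obtain':
  assumes "F \<in> \<Delta>" "F \<noteq> {}"
  obtains r I where "r < l" "cyc_indep m I" "I \<noteq> {}" "F = pt r ` I"
proof -
  obtain a where a: "a \<in> F" using assms(2) by blast
  have r: "a mod l < l" using l_pos by simp
  let ?I = "{i\<in>{..<m}. pt (a mod l) i \<in> F}"
  have F: "F = pt (a mod l) ` ?I"
  proof (intro equalityI subsetI)
    fix b assume b: "b \<in> F"
    have "b = pt (a mod l) (b div l)"
      using same_copy[OF assms(1) b a] pt_surj[OF face_less[OF assms(1) b]] by simp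
    then show "b \<in> pt (a mod l) ` ?I" using b div_less_m[OF face_less[OF assms(1) b]] by force
  qed auto
  moreover have "cyc_indep m ?I" using indep_pt[OF r, of ?I 0] F assms(1) by auto
  ultimately show ?thesis using that[OF r] a by blast
qed

text \<open>A nonempty subset of one copy dominates all other copies for free, so maximality becomes
  a question about a single cycle.\<close>

lemma maximal_pt:
  assumes "r < l" "I \<subseteq> {..<m}" "I \<noteq> {}"
  shows "maximal_independent {..<l * m} adj ((\<lambda>i. pt r (k + i)) ` I) \<longleftrightarrow>
    cyc_indep m I \<and> cyc_dominating m I"
proof -
  let ?h = "\<lambda>i. pt r (k + i)"
  have lt: "i < m" if "i \<in> I" for i using assms(2) that by auto
  have dom: "?h i \<in> ?h ` I \<or> (\<exists>x\<in>?h ` I. adj x (?h i)) \<longleftrightarrow>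
      i \<in> I \<or> Suc i mod m \<in> I \<or> (\<exists>j\<in>I. Suc j mod m = i)" if "i < m" for i
  proof -
    have "?h i \<in> ?h ` I \<longleftrightarrow> i \<in> I"
      using inj_on_image_mem_iff[OF inj_on_pt[OF assms(1)]] that assms(2) by auto
    moreover have "(\<exists>x\<in>?h ` I. adj x (?h i)) \<longleftrightarrow> (\<exists>j\<in>I. Suc j mod m = i \<or> Suc i mod m = j)"
      using lt that by (auto simp: adj_pt_add[OF assms(1)])
    ultimately show ?thesis by blast
  qed
  have "(\<forall>y\<in>{..<l * m}. y \<in> ?h ` I \<or> (\<exists>x\<in>?h ` I. adj x y)) \<longleftrightarrow> cyc_dominating m I"
  proof
    assume L: "\<forall>y\<in>{..<l * m}. y \<in> ?h ` I \<or> (\<exists>x\<in>?h ` I. adj x y)"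
    then show "cyc_dominating m I" unfolding cyc_dominating_def
      using dom pt_less[OF assms(1)] by (metis lessThan_iff)
  next
    assume R: "cyc_dominating m I"
    show "\<forall>y\<in>{..<l * m}. y \<in> ?h ` I \<or> (\<exists>x\<in>?h ` I. adj x y)"
    proof
      fix y assume "y \<in> {..<l * m}"
      then have y: "y < l * m" by simp
      show "y \<in> ?h ` I \<or> (\<exists>x\<in>?h ` I. adj x y)"
      proof (cases "y mod l = r")
        case True
        then obtain i where i: "i < m" "y = ?h i" using pt_surj_add[OF y _ assms(1)] by blast
        then have "i \<in> I \<or> Suc i mod m \<in> I \<or> (\<exists>j\<in>I. Suc j mod m = i)"
          using R unfolding cyc_dominating_def by simp
        then show ?thesis unfolding i(2) dom[OF i(1)] .
      next
        case False
        then have "adj (?h i) y" for i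
          using y pt_less[OF assms(1)] pt_mod[OF assms(1)] unfolding adj_def by auto
        then show ?thesis using assms(3) by blast
      qed
    qed
  qed
  moreover have "?h ` I \<subseteq> {..<l * m} \<and> independent adj (?h ` I) \<longleftrightarrow> cyc_indep m I"
    using indep_pt[OF assms(1,2)] unfolding \<Delta>_def indep_complex_def by simp
  ultimately show ?thesis unfolding maximal_independent_iff[OF symp_adj irreflp_adj] by blast
qed

lemma card_pt_image: "r < l \<Longrightarrow> I \<subseteq> {..<m} \<Longrightarrow> card ((\<lambda>i. pt r (k + i)) ` I) = card I"
  by (rule card_image[OF inj_on_subset[OF inj_on_pt]])

lemma face_card_le:
  assumes "F \<in> \<Delta>"
  shows "card F \<le> m div 2"
proof (cases "F = {}")
  case False
  then obtain r I where I: "r < l" "cyc_indep m I" "F = pt r ` I" using face_obtain'[OF assms] by blast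
  then have "card F = card I" using card_pt_image[of r I 0] unfolding cyc_indep_def by simp
  then show ?thesis using cyc_indep_card[OF I(2)] by simp
qed simp

lemma facet_card:
  assumes "m \<in> {3, 4, 5, 7}" "F \<in> facets \<Delta>"
  shows "card F = m div 2"
proof -
  have F: "F \<in> \<Delta>" using facetsD[OF assms(2)] .
  have max: "maximal_independent {..<l * m} adj F" using assms(2) unfolding \<Delta>_def facets_indep_complex by simp
  have "(\<lambda>i. pt 0 (0 + i)) ` {0} \<in> \<Delta>"
    by (subst indep_pt) (use l_pos m_ge_3 in \<open>auto simp: cyc_indep_def\<close>)
  then have "{pt 0 0} \<in> \<Delta>" by simp
  then have "F \<noteq> {}" using assms(2) unfolding facets_def by auto
  then obtain r I where I: "r < l" "cyc_indep m I" "I \<noteq> {}" "F = pt r ` I" using face_obtain'[OF F] by blast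
  have sub: "I \<subseteq> {..<m}" using I(2) unfolding cyc_indep_def by blast
  have "cyc_dominating m I" using maximal_pt[OF I(1) sub I(3), of 0] max I(4) by simp
  then have "m \<le> 3 * card I" using cyc_dominating_card sub by blast
  moreover have "2 * card I \<le> m" using cyc_indep_card[OF I(2)] by simp
  moreover have "card F = card I" using card_pt_image[OF I(1) sub, of 0] I(4) by simp
  ultimately show ?thesis using assms(1) by auto
qed

text \<open>In the \<open>m\<close>-cycle with \<open>m = 6\<close> or \<open>m \<ge> 8\<close>, this independent set dominates exactly the
  vertices other than 0, 1 and 2.\<close>

definition obstruction :: "nat set" where
  "obstruction = insert 4 {y\<in>{6..m - 2}. even y = even m}"

context
  assumes m_not: "m \<notin> {3, 4, 5, 7}"
begin

lemma m_ge_6: "m = 6 \<or> 8 \<le> m"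
  using m_not m_ge_3 by (auto; arith)

lemma obstruction_range: "obstruction \<subseteq> {4..m - 2}"
  using m_ge_6 unfolding obstruction_def by auto

lemma obstruction_gap: "y \<in> obstruction \<Longrightarrow> Suc y \<notin> obstruction"
  using m_ge_6 unfolding obstruction_def by auto

text \<open>The parity condition makes the set end at \<open>m - 2\<close>, which takes care of
  \<open>m - 1\<close> but not of 0. From 6 on the gaps are 2; for \<open>m \<ge> 8\<close> the gap
  after 4 is 2 or 3 and absorbs the parity of \<open>m\<close>.\<close>

lemma obstruction_dominates:
  assumes "3 \<le> y" "y < m"
  shows "y \<in> obstruction \<or> Suc y \<in> obstruction \<or> (\<exists>j\<in>obstruction. Suc j = y)"
proof -
  consider "y = 3" | "y = 4" | "y = 5" | "y \<ge> 6" "even y = even m" "y \<noteq> m" | "y \<ge> 6" "even y \<noteq> even m" "y + 1 \<noteq> m"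
    | "y \<ge> 6" "y + 1 = m" using assms by linarith
  then show ?thesis
  proof cases
    case 4
    then have "y \<noteq> m - 1" using m_ge_6 by auto
    then show ?thesis using 4 assms by (auto simp: obstruction_def)
  next
    case 5
    then have "y + 2 \<noteq> m" by auto
    then show ?thesis using 5 assms by (auto simp: obstruction_def)
  next
    case 6
    then have "y - 1 \<in> obstruction" using m_ge_6 by (auto simp: obstruction_def)
    then show ?thesis using 6 by force
  qed (auto simp: obstruction_def)
qed

text \<open>What is left undominated is the path 0, 1, 2, whose maximal independent sets are
  \<open>{1}\<close> and \<open>{0, 2}\<close>. Their different sizes refute well-coveredness, and
  they become the facets of the link.\<close>

lemma cyc_indep_obstruction:
  assumes "A = {1} \<or> A = {0, 2}"
  shows "cyc_indep m (obstruction \<union> A)" "cyc_dominating m (obstruction \<union> A)"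
proof -
  have 3: "2 < y \<Longrightarrow> y \<in> obstruction \<union> A \<longleftrightarrow> y \<in> obstruction" for y using assms by auto
  have lo: "y < 4 \<Longrightarrow> y \<notin> obstruction" and hi: "m - 2 < y \<Longrightarrow> y \<notin> obstruction" for y
    using obstruction_range by auto
  show "cyc_indep m (obstruction \<union> A)" unfolding cyc_indep_def
  proof (intro conjI ballI)
    have "{4..m - 2} \<subseteq> {..<m}" "A \<subseteq> {..<m}" using assms m_ge_6 by auto
    then show "obstruction \<union> A \<subseteq> {..<m}" using obstruction_range by blast
    fix i assume i: "i \<in> obstruction \<union> A"
    show "Suc i mod m \<notin> obstruction \<union> A"
    proof (cases "i \<in> obstruction")
      case True
      then have "4 \<le> i" "i \<le> m - 2" using obstruction_range by auto
      then show ?thesis using obstruction_gap[OF True] 3[of "Suc i"] m_ge_6 by simp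
    next
      case False
      then have "i \<in> A" using i by blast
      moreover from this have "Suc i mod m = Suc i" using assms m_ge_6 by (intro mod_less) auto
      ultimately show ?thesis using assms lo by auto
    qed
  qed
  show "cyc_dominating m (obstruction \<union> A)" unfolding cyc_dominating_def
  proof (intro allI impI)
    fix i assume i: "i < m"
    show "i \<in> obstruction \<union> A \<or> Suc i mod m \<in> obstruction \<union> A \<or>
      (\<exists>j\<in>obstruction \<union> A. Suc j mod m = i)"
    proof (cases "3 \<le> i")
      case True
      consider "i \<in> obstruction" | "Suc i \<in> obstruction" | j where "j \<in> obstruction" "Suc j = i"
        using obstruction_dominates[OF True i] by blast
      then show ?thesis
      proof cases
        case 2
        then have "Suc i \<le> m - 2" using hi linorder_not_le by blast
        then show ?thesis using 2 i by simp
      next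
        case 3
        then have "Suc j mod m = i" using i by simp
        then show ?thesis using 3(1) by blast
      qed simp
    next
      case False
      then have "i = 0 \<or> i = 1 \<or> i = 2" by auto
      then show ?thesis using assms m_ge_6 by auto
    qed
  qed
qed

end

end

section \<open>Obstructions\<close>

lemma finite_complex_pure_skeleton:
  assumes "finite_complex D"
  shows "finite_complex (pure_skeleton D i)" "pure_skeleton D i \<subseteq> D"
proof -
  show sub: "pure_skeleton D i \<subseteq> D"
    using finite_complexD(3)[OF assms] unfolding pure_skeleton_def faces_of_dim_def by blast
  have "finite (pure_skeleton D i)" using finite_subset[OF sub] finite_complexD(1)[OF assms] by blast
  moreover have "finite F" if "F \<in> pure_skeleton D i" for F using finite_complexD(2)[OF assms] sub that by blast
  moreover have "G \<in> pure_skeleton D i" if "F \<in> pure_skeleton D i" "G \<subseteq> F" for F G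
    using that unfolding pure_skeleton_def by blast
  ultimately show "finite_complex (pure_skeleton D i)" unfolding finite_complex_def by blast
qed

lemma pure_skeletonI: "F \<in> D \<Longrightarrow> int (card F) = i + 1 \<Longrightarrow> G \<subseteq> F \<Longrightarrow> G \<in> pure_skeleton D i"
  unfolding pure_skeleton_def faces_of_dim_def by blast

lemma pure_skeleton_top:
  assumes "finite_complex D" "\<And>F. F \<in> facets D \<Longrightarrow> int (card F) = i + 1"
  shows "pure_skeleton D i = D"
proof
  show "D \<subseteq> pure_skeleton D i"
  proof
    fix F assume "F \<in> D"
    then obtain M where M: "M \<in> facets D" "F \<subseteq> M" using facet_above[OF assms(1)] by blast
    show "F \<in> pure_skeleton D i" by (rule pure_skeletonI[OF facetsD[OF M(1)] assms(2)[OF M(1)] M(2)])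
  qed
qed (rule finite_complex_pure_skeleton[OF assms(1)])

text \<open>Independence forbids two successive members, and the covering hypothesis forbids two
  successive non-members.\<close>

lemma cyc_extremal_alternates:
  assumes I: "cyc_indep m I" and ab: "a \<le> b" "b < m" "a \<in> I"
    and cover: "\<And>y. a < y \<Longrightarrow> y \<le> b \<Longrightarrow> y \<in> I \<union> (\<lambda>i. Suc i mod m) ` I"
  shows "b \<in> I \<longleftrightarrow> even (b - a)"
  using ab cover
proof (induction b rule: dec_induct)
  case (step b)
  have IH: "b \<in> I \<longleftrightarrow> even (b - a)" using step by simp
  have lt: "i < m" if "i \<in> I" for i using I that unfolding cyc_indep_def by auto
  have "Suc b \<in> I \<longleftrightarrow> b \<notin> I"
  proof
    assume "Suc b \<in> I"
    then show "b \<notin> I" using I step.prems(1) unfolding cyc_indep_def by force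
  next
    assume b: "b \<notin> I"
    have "Suc b \<in> I \<union> (\<lambda>i. Suc i mod m) ` I" using step.prems(3) step.hyps by simp
    moreover have "i = b" if "Suc b = Suc i mod m" "i \<in> I" for i
      using that lt[OF that(2)] by (auto simp: Suc_mod_cases split: if_splits)
    ultimately show "Suc b \<in> I" using b by blast
  qed
  then show ?case using IH step.hyps by (simp add: Suc_diff_le)
qed simp

text \<open>An independent set of size \<open>m div 2\<close> and its translate leave only \<open>m mod 2\<close> vertices uncovered,
  and parity can only change across an uncovered vertex.\<close>

lemma cyc_extremal_uncovered:
  assumes I: "cyc_indep m I" "card I = m div 2"
    and ab: "a \<in> I" "b \<in> I" "a < b" "even a \<noteq> even b"
  shows "odd m" "\<exists>y\<in>{a<..b}. {..<m} - (I \<union> (\<lambda>i. Suc i mod m) ` I) = {y}"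
proof -
  let ?U = "{..<m} - (I \<union> (\<lambda>i. Suc i mod m) ` I)"
  have "b < m" using I(1) ab unfolding cyc_indep_def by auto
  moreover have "odd (b - a)" using ab by simp
  ultimately have "\<not> (\<forall>y. a < y \<and> y \<le> b \<longrightarrow> y \<in> I \<union> (\<lambda>i. Suc i mod m) ` I)"
    using cyc_extremal_alternates[OF I(1) _ _ ab(1)] ab by (metis less_imp_le)
  then obtain y where y: "a < y" "y \<le> b" "y \<in> ?U" using \<open>b < m\<close> by auto
  have card: "card ?U + 2 * (m div 2) = m" using cyc_indep_card[OF I(1)] I(2) by simp
  moreover have "card ?U \<noteq> 0" using y(3) by (metis card_0_eq empty_iff finite_Diff finite_lessThan)
  ultimately show "odd m" by (metis add_cancel_left_left dvd_mult_div_cancel)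
  with card have "card ?U = 1" by presburger
  then show "\<exists>y\<in>{a<..b}. ?U = {y}" using y by (metis card_1_singletonE greaterThanAtMost_iff singletonD)
qed

text \<open>Each change of parity uses up an uncovered vertex. The two half-open intervals are
  disjoint, but only one such vertex exists.\<close>

lemma cyc_extremal_no_alternating_triple:
  assumes I: "cyc_indep m I" "card I = m div 2"
    and abc: "a \<in> I" "b \<in> I" "c \<in> I" "a < b" "b < c" "even a \<noteq> even b"
  shows "even b = even c"
proof (rule ccontr)
  assume "even b \<noteq> even c"
  then obtain y z where "y \<in> {a<..b}" "z \<in> {b<..c}" "{y} = {z}"
    using cyc_extremal_uncovered(2)[OF I] abc by (metis (no_types, lifting))
  then show False by auto
qed

text \<open>The independent sets of size \<open>p\<close> in the cycle on \<open>2 * p + 1\<close> vertices, for \<open>s \<le> 1\<close>: all gaps are 2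
  except one gap 3, which precedes the \<open>k\<close>-th element (or wraps around).\<close>

definition zigzag :: "nat \<Rightarrow> nat \<Rightarrow> nat \<Rightarrow> nat set" where
  "zigzag p s k = (\<lambda>t. 2 * t + s + (if k \<le> t then 1 else 0)) ` {..<p}"

lemma card_zigzag: "card (zigzag p s k) = p"
proof -
  have "inj_on (\<lambda>t. 2 * t + s + (if k \<le> t then 1 else 0)) {..<p}"
    by (rule inj_onI, simp split: if_splits; presburger)
  then show ?thesis unfolding zigzag_def by (simp add: card_image)
qed

lemma cyc_indep_zigzag:
  assumes "s \<le> 1"
  shows "cyc_indep (2 * p + 1) (zigzag p s k)"
  unfolding cyc_indep_def
proof (intro conjI ballI)
  show "zigzag p s k \<subseteq> {..<2 * p + 1}" using assms unfolding zigzag_def by auto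
  fix i assume "i \<in> zigzag p s k"
  then obtain t where t: "t < p" "i = 2 * t + s + (if k \<le> t then 1 else 0)" unfolding zigzag_def by auto
  have "Suc i mod (2 * p + 1) \<noteq> 2 * t' + s + (if k \<le> t' then 1 else 0)" if "t' < p" for t'
  proof (cases "Suc i = 2 * p + 1")
    case True
    \<comment> \<open>At the wrap-around \<open>i\<close> is \<open>2 * p\<close>, which is reached
      only for \<open>s = 1\<close>; then 0 is not in the set.\<close>
    then have "s = 1" using t assms by (simp split: if_splits; presburger)
    then show ?thesis using True by simp
  next
    case False
    then have "Suc i mod (2 * p + 1) = Suc i" using t assms by (auto split: if_splits)
    moreover have "Suc i \<noteq> 2 * t' + s + (if k \<le> t' then 1 else 0)"
      unfolding t(2) by (cases "k \<le> t"; cases "k \<le> t'"; simp; presburger)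
    ultimately show ?thesis by simp
  qed
  then show "Suc i mod (2 * p + 1) \<notin> zigzag p s k" unfolding zigzag_def by auto
qed

text \<open>These are the edges of the closed walk used in \<open>odd_cycle_complex\<close>. Each is
  brought into an extremal set by a suitable position of the gap 3.\<close>

lemma zigzag_edges:
  assumes "2 \<le> p"
  shows "i + 2 \<le> 2 * p \<Longrightarrow> \<exists>s\<le>1. \<exists>k. {i, i + 2} \<subseteq> zigzag p s k"
    and "{1, 2 * p} \<subseteq> zigzag p 1 1" "{0, 2 * p - 1} \<subseteq> zigzag p 0 1"
proof -
  have zz: "2 * t + s + (if k \<le> t then 1 else 0) \<in> zigzag p s k" if "t < p" for s t k
    using that unfolding zigzag_def by blast
  show "{1, 2 * p} \<subseteq> zigzag p 1 1" "{0, 2 * p - 1} \<subseteq> zigzag p 0 1"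
    using zz[of 0 1 1] zz[of "p - 1" 1 1] zz[of 0 0 1] zz[of "p - 1" 0 1] assms
      le_add_diff_inverse2[OF assms]
    by (simp_all add: diff_mult_distrib2 Suc_diff_le numeral_2_eq_2 split: if_splits)
  assume i: "i + 2 \<le> 2 * p"
  \<comment> \<open>The extremal set of even numbers from 0 stops at \<open>2 * p - 2\<close>, and
    the one that reaches \<open>2 * p\<close> starts at 2; hence the separate case
    \<open>i = 0\<close>.\<close>
  consider "i = 0" | u where "i = 2 * u + 1" | u where "i = 2 * Suc u"
    by (metis evenE oddE not0_implies_Suc mult_0_right)
  then show "\<exists>s\<le>1. \<exists>k. {i, i + 2} \<subseteq> zigzag p s k"
  proof cases
    case 1
    then have "{i, i + 2} \<subseteq> zigzag p 0 p" using zz[of 0 0 p] zz[of 1 0 p] assms by (simp add: numeral_2_eq_2)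
    then show ?thesis by blast
  next
    case 2
    then have "{i, i + 2} \<subseteq> zigzag p 1 p" using zz[of u 1 p] zz[of "Suc u" 1 p] i by simp
    then show ?thesis by blast
  next
    case 3
    then have "{i, i + 2} \<subseteq> zigzag p 1 0" using zz[of u 1 0] zz[of "Suc u" 1 0] i by simp
    then show ?thesis by blast
  qed
qed

lemma obtain_sorted_triple:
  assumes "card (t :: 'a::linorder set) = 3"
  obtains a b c where "a < b" "b < c" "t = {a, b, c}"
proof -
  have fin: "finite t" "t \<noteq> {}" using assms by (auto intro: card_ge_0_finite)
  then have "card (t - {Min t}) = 2" using assms by simp
  then obtain b c where bc: "b < c" "t - {Min t} = {b, c}" by (rule card_2_linorder_obtain)
  then have "t = {Min t, b, c}" using Min_in[OF fin] by blast
  moreover have "Min t < b" using bc Min_le[OF fin(1), of b] by (metis DiffE insertI1 singletonI order_le_imp_less_or_eq)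
  ultimately show ?thesis using that bc(1) by blast
qed

lemma sum_triple_signed:
  fixes f :: "'a::linorder \<Rightarrow> 'k::field"
  assumes "a < b" "b < c"
  shows "(\<Sum>v\<in>{a, b, c}. (- 1) ^ card {u\<in>{a, b, c}. u < v} * f v) = f a - f b + f c"
proof -
  have s: "{u\<in>{a, b, c}. u < a} = {}" "{u\<in>{a, b, c}. u < b} = {a}" "{u\<in>{a, b, c}. u < c} = {a, b}"
    using assms by auto
  have "a \<notin> {b, c}" "b \<notin> {c}" and ab: "a \<noteq> b" using assms by auto
  then have "(\<Sum>v\<in>{a, b, c}. (- 1) ^ card {u\<in>{a, b, c}. u < v} * f v)
    = (- 1) ^ card {u\<in>{a, b, c}. u < a} * f a + ((- 1) ^ card {u\<in>{a, b, c}. u < b} * f b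
      + (- 1) ^ card {u\<in>{a, b, c}. u < c} * f c)"
    by (subst sum.insert, simp, simp, subst sum.insert) simp_all
  then show ?thesis unfolding s using ab by simp
qed

text \<open>Recording only the edges of the closed walk lets the same facts apply to the top
  skeletons of all odd cycles with \<open>p \<ge> 2\<close> and to \<open>\<Delta>\<close> itself
  for \<open>m = 5\<close> and \<open>m = 7\<close>.\<close>

locale odd_cycle_complex =
  fixes D :: "nat set set" and p :: nat
  assumes D: "finite_complex D" and p_ge_2: "2 \<le> p" and range: "\<Union>D \<subseteq> {..2 * p}"
    and step_edge: "\<And>i. i + 2 \<le> 2 * p \<Longrightarrow> {i, i + 2} \<in> D"
    and wrap_edge: "{1, 2 * p} \<in> D" "{0, 2 * p - 1} \<in> D"
begin

text \<open>The walk passes through all even vertices and then, by the edge from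
  \<open>2 * p\<close> to 1, through all odd ones.\<close>

lemma connected: "complex_connected D"
proof (rule complex_connectedI[where u = 0])
  let ?R = "\<lambda>a b. {a, b} \<in> D"
  have step: "?R\<^sup>*\<^sup>* i (i + 2 * k)" if "i + 2 * k \<le> 2 * p" for i k
    using that
  proof (induction k)
    case (Suc k)
    then have "?R (i + 2 * k) (i + 2 * Suc k)" using step_edge[of "i + 2 * k"] by simp
    then show ?case using Suc by (auto intro: rtranclp.rtrancl_into_rtrancl)
  qed simp
  have "{2 * p, 1} \<in> D" using wrap_edge by (simp add: insert_commute)
  then have one: "?R\<^sup>*\<^sup>* 0 1" using step[of 0 p] by (auto intro: rtranclp.rtrancl_into_rtrancl)
  fix v assume "v \<in> \<Union>D"
  then have "v \<le> 2 * p" using range by auto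
  show "?R\<^sup>*\<^sup>* 0 v"
  proof (cases "even v")
    case True
    then obtain k where "v = 2 * k" by blast
    then show ?thesis using step[of 0 k] \<open>v \<le> 2 * p\<close> by simp
  next
    case False
    then obtain k where "v = 1 + 2 * k" by (metis oddE add.commute)
    then have "?R\<^sup>*\<^sup>* 1 v" using step[of 1 k] \<open>v \<le> 2 * p\<close> by simp
    then show ?thesis using one by (rule rtranclp_trans[rotated])
  qed
qed

text \<open>The cochain \<open>\<phi>\<close> marks the edges joining a smaller odd to a larger even vertex. It is a cocycle
  because no triangle alternates in parity, and the closed walk
  \<open>0, 2, \<dots>, 2 * p, 1, 3, \<dots>, 2 * p - 1, 0\<close>, whose chain is \<open>c\<close>, uses exactly one marked edge.\<close>

lemma not_H1:
  fixes K :: "'k::field itself"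
  assumes alt: "\<And>a b c. {a, b, c} \<in> D \<Longrightarrow> a < b \<Longrightarrow> b < c \<Longrightarrow> even a \<noteq> even b \<Longrightarrow> even b = even c"
  shows "\<not> reduced_homology_vanishes K D 1"
proof -
  \<comment> \<open>The coefficient of the walk on an edge \<open>a < b\<close>: steps by 2 ascend,
    while the two wrap-around steps, from \<open>2 * p\<close> to 1 and from
    \<open>2 * p - 1\<close> to 0, descend and get the opposite sign.\<close>
  define g :: "nat \<Rightarrow> nat \<Rightarrow> 'k" where
    "g a b = (if b = a + 2 then 1 else if (a, b) = (1, 2 * p) \<or> (a, b) = (0, 2 * p - 1) then - 1 else 0)"
    for a b
  define c :: "nat set \<Rightarrow> 'k" where
    "c F = (if F \<in> D \<and> card F = 2 then g (Min F) (Max F) else 0)" for F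
  define \<phi> :: "nat set \<Rightarrow> 'k" where "\<phi> e = (if odd (Min e) \<and> even (Max e) then 1 else 0)" for e
  have c_edge: "c {a, b} = (if {a, b} \<in> D then g a b else 0)" if "a < b" for a b
    using that by (simp add: c_def)
  have \<phi>_edge: "\<phi> {a, b} = (if odd a \<and> even b then 1 else 0)" if "a < b" for a b
    using that by (simp add: \<phi>_def)
  show ?thesis
  proof (rule cocycle_obstruction[OF D, where c = c and \<phi> = \<phi>])
    fix t assume "t \<in> faces_of_dim D (1 + 1)"
    then have t: "t \<in> D" "card t = 3" unfolding faces_of_dim_def by auto
    then obtain x y z where xyz: "x < y" "y < z" "t = {x, y, z}" by (elim obtain_sorted_triple)
    then have d: "t - {x} = {y, z}" "t - {y} = {x, z}" "t - {z} = {x, y}" by auto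
    have "(\<Sum>v\<in>t. (- 1) ^ card {u \<in> t. u < v} * \<phi> (t - {v})) = \<phi> (t - {x}) - \<phi> (t - {y}) + \<phi> (t - {z})"
      unfolding xyz(3) by (rule sum_triple_signed[OF xyz(1,2)])
    \<comment> \<open>Without alternation the parity changes at most once along
      \<open>x < y < z\<close>. A change from odd to even marks \<open>{x, z}\<close> and exactly
      one of the other two edges, and the two contributions cancel.\<close>
    also have "\<dots> = 0"
      unfolding d using alt[of x y z] t(1) xyz by (auto simp: \<phi>_edge)
    finally show "(\<Sum>v\<in>t. (- 1) ^ card {u \<in> t. u < v} * \<phi> (t - {v})) = 0" .
  next
    show "is_chain D 1 c" unfolding is_chain_def faces_of_dim_def c_def by auto
  next
    fix G assume "G \<in> faces_of_dim D (1 - 1)"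
    then obtain w where w: "w \<in> \<Union>D" "G = {w}" using faces_of_dim_0[OF D] by auto
    let ?N = "{v. v \<notin> {w} \<and> insert v {w} \<in> D}"
    \<comment> \<open>\<open>s\<close> and \<open>q\<close> are the successor and the predecessor of
      \<open>w\<close> on the walk; no other edge at \<open>w\<close> carries a nonzero
      coefficient.\<close>
    define s where "s = (if w + 2 \<le> 2 * p then w + 2 else if w = 2 * p then 1 else 0)"
    define q where "q = (if 2 \<le> w then w - 2 else if w = 1 then 2 * p else 2 * p - 1)"
    let ?\<sigma> = "\<lambda>v. if v < w then g v w else - g w v"
    have wle: "w \<le> 2 * p" using w range by auto
    have finN: "finite ?N" by (rule finite_subset[OF _ finite_vertices[OF D]]) auto
    have val: "(- 1) ^ card {u\<in>{w}. u < v} * c (insert v {w}) = ?\<sigma> v" if "v \<in> ?N" for v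
    proof (cases "v < w")
      case True
      then have e: "{u\<in>{w}. u < v} = {}" by auto
      show ?thesis unfolding e using that True by (simp add: c_edge)
    next
      case False
      then have e: "{u\<in>{w}. u < v} = {w}" using that by auto
      have "c (insert v {w}) = g w v"
        using that False c_edge[of w v] by (simp add: insert_commute)
      then show ?thesis unfolding e using False by simp
    qed
    have "boundary D c G = (\<Sum>v\<in>?N. ?\<sigma> v)"
      unfolding boundary_def w(2) by (rule sum.cong) (use val in auto)
    also have "\<dots> = (\<Sum>v\<in>{s, q}. ?\<sigma> v)"
    proof (rule sum.mono_neutral_right[OF finN])
      have "{w - 2, w} \<in> D" if "2 \<le> w" using step_edge[of "w - 2"] that wle le_add_diff_inverse2[OF that] by simp
      moreover have "{w + 2, w} \<in> D" if "w + 2 \<le> 2 * p" using step_edge[OF that] by (simp add: insert_commute)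
      moreover have "{2 * p, 1} \<in> D" "{2 * p - 1, 0} \<in> D" using wrap_edge by (simp_all add: insert_commute)
      moreover have "w = 0 \<or> w = 1 \<or> 2 \<le> w" "w + 2 \<le> 2 * p \<or> w = 2 * p - 1 \<or> w = 2 * p"
        using wle by linarith+
      ultimately have "{s, w} \<in> D" "{q, w} \<in> D"
        unfolding s_def q_def using wrap_edge p_ge_2 by (elim disjE; simp)+
      moreover have "s \<noteq> w" "q \<noteq> w" unfolding s_def q_def using wle p_ge_2 by (auto split: if_split)
      ultimately show "{s, q} \<subseteq> ?N" by blast
      show "\<forall>v\<in>?N - {s, q}. ?\<sigma> v = 0"
      proof
        fix v assume v: "v \<in> ?N - {s, q}"
        then have "v \<le> 2 * p" "v \<noteq> w" using range by auto
        then show "?\<sigma> v = 0" using v wle p_ge_2 unfolding s_def q_def g_def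
          by (auto split: if_splits)
      qed
    qed
    also have "\<dots> = ?\<sigma> s + ?\<sigma> q"
    proof -
      have "s \<noteq> q" using wle p_ge_2 unfolding s_def q_def by (auto split: if_splits)
      then show ?thesis by simp
    qed
    also have "?\<sigma> s = - 1" using wle p_ge_2 unfolding s_def g_def by auto
    also have "?\<sigma> q = 1" using wle p_ge_2 unfolding q_def g_def by auto
    finally show "boundary D c G = 0" by simp
  next
    have e: "{1, 2 * p} \<in> faces_of_dim D 1" using wrap_edge p_ge_2 unfolding faces_of_dim_def by auto
    have "(\<Sum>e\<in>faces_of_dim D 1. \<phi> e * c e) = (\<Sum>e\<in>{{1, 2 * p}}. \<phi> e * c e)"
    proof (rule sum.mono_neutral_right)
      show "finite (faces_of_dim D 1)" using finite_complexD(1)[OF D] unfolding faces_of_dim_def by simp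
      show "\<forall>e\<in>faces_of_dim D 1 - {{1, 2 * p}}. \<phi> e * c e = 0"
      proof
        fix e assume e: "e \<in> faces_of_dim D 1 - {{1, 2 * p}}"
        then have "card e = 2" unfolding faces_of_dim_def by auto
        then obtain a b where "a < b" "e = {a, b}" by (rule card_2_linorder_obtain)
        then show "\<phi> e * c e = 0" using e by (auto simp: \<phi>_edge c_edge g_def)
      qed
    qed (use e in blast)
    also have "\<dots> = - 1" using p_ge_2 wrap_edge by (simp add: \<phi>_edge c_edge g_def)
    finally show "(\<Sum>e\<in>faces_of_dim D 1. \<phi> e * c e) \<noteq> 0" by simp
  qed
qed

end

section \<open>Non-Cohen--Macaulay links and skeletons of joins of cycles\<close>

context cycle_join
begin

lemma not_well_covered:
  assumes "m \<notin> {3, 4, 5, 7}"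
  shows "\<not> well_covered {..<l * m} adj"
proof -
  let ?O = "obstruction"
  have max: "maximal_independent {..<l * m} adj ((\<lambda>i. pt 0 (0 + i)) ` (?O \<union> A))"
    "card ((\<lambda>i. pt 0 (0 + i)) ` (?O \<union> A)) = card ?O + card A" if A: "A = {1} \<or> A = {0, 2}" for A
  proof -
    have sub: "?O \<union> A \<subseteq> {..<m}" using cyc_indep_obstruction(1)[OF assms A] unfolding cyc_indep_def by blast
    show "maximal_independent {..<l * m} adj ((\<lambda>i. pt 0 (0 + i)) ` (?O \<union> A))"
      by (subst maximal_pt[OF _ sub]) (use cyc_indep_obstruction[OF assms A] A l_pos in auto)
    have "finite ?O" "?O \<inter> A = {}" using obstruction_range[OF assms] A finite_subset by auto
    then have "card (?O \<union> A) = card ?O + card A" using A by (intro card_Un_disjoint) auto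
    then show "card ((\<lambda>i. pt 0 (0 + i)) ` (?O \<union> A)) = card ?O + card A"
      using card_pt_image[OF _ sub, of 0 0] l_pos by simp
  qed
  show ?thesis
  proof
    assume "well_covered {..<l * m} adj"
    then have "card ((\<lambda>i. pt 0 (0 + i)) ` (?O \<union> {1})) = card ((\<lambda>i. pt 0 (0 + i)) ` (?O \<union> {0, 2}))"
      using max(1)[of "{1}"] max(1)[of "{0, 2}"] unfolding well_covered_def by blast
    then have "card ?O + card {1 :: nat} = card ?O + card {0 :: nat, 2}" by (simp only: max(2) simp_thms)
    then show False by simp
  qed
qed

text \<open>Together with \<open>pt 0 1\<close> the obstruction is already a maximal independent
  set, so \<open>pt 0 1\<close> is isolated in the link. The equivalence is the invariant along
  edges that the separation lemmas ask for.\<close>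

lemma obstruction_link:
  assumes "m \<notin> {3, 4, 5, 7}"
  defines "L \<equiv> link \<Delta> (pt 0 ` obstruction)"
  shows "pt 0 ` obstruction \<in> \<Delta>" "{pt 0 0, pt 0 2} \<in> L" "{pt 0 1} \<in> L"
    and "{a, b} \<in> L \<Longrightarrow> a = pt 0 1 \<longleftrightarrow> b = pt 0 1" and "card {pt 0 0, pt 0 2} = 2"
proof -
  have l: "0 < l" using l_pos by simp
  note m6 = m_ge_6[OF assms(1)]
  let ?F = "pt 0 ` obstruction"
  have ran: "obstruction \<subseteq> {4..m - 2}" using obstruction_range[OF assms(1)] .
  have face: "pt 0 ` (obstruction \<union> A) \<in> \<Delta>" if "A = {1} \<or> A = {0, 2}" for A
    using indep_pt[OF l, of "obstruction \<union> A" 0] cyc_indep_obstruction(1)[OF assms(1) that]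
    unfolding cyc_indep_def by simp
  have dc: "\<And>F G. F \<in> \<Delta> \<Longrightarrow> G \<subseteq> F \<Longrightarrow> G \<in> \<Delta>" using finite_complexD(3)[OF finite_complex_\<Delta>] .
  have notin: "pt 0 i \<notin> ?F" if "i < 4" for i
  proof
    assume "pt 0 i \<in> ?F"
    then obtain j where j: "j \<in> obstruction" "pt 0 i = pt 0 j" by blast
    then have "4 \<le> j" "j \<le> m - 2" using ran by auto
    then have "4 \<le> j" "j < m" "i < m" using that m6 by linarith+
    then show False using that j(2) pt_eq_iff[OF l l, of i j] by simp
  qed
  show "?F \<in> \<Delta>" by (rule dc[OF face[of "{1}"]]) auto
  show "{pt 0 0, pt 0 2} \<in> L" "{pt 0 1} \<in> L"
    using face[of "{0, 2}"] face[of "{1}"] dc notin unfolding L_def link_def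
    by (auto simp: Un_commute)
  have "2 mod m = 2" using m6 by auto
  then have "pt 0 0 \<noteq> pt 0 2" unfolding pt_eq_iff[OF l l] by simp
  then show "card {pt 0 0, pt 0 2} = 2" by simp
  have max: "maximal_independent {..<l * m} adj (pt 0 ` (obstruction \<union> {1}))"
    using maximal_pt[OF l, of "obstruction \<union> {1}" 0] cyc_indep_obstruction[OF assms(1), of "{1}"]
    unfolding cyc_indep_def by simp
  have key: "b = pt 0 1" if "{pt 0 1, b} \<in> L" for b
  proof -
    have "{pt 0 1, b} \<union> ?F \<in> \<Delta>" "b \<notin> ?F" using that unfolding L_def link_def by auto
    moreover have "pt 0 ` (obstruction \<union> {1}) \<subseteq> {pt 0 1, b} \<union> ?F" by auto
    ultimately have "{pt 0 1, b} \<union> ?F = pt 0 ` (obstruction \<union> {1})"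
      using max unfolding maximal_independent_def \<Delta>_def indep_complex_def by blast
    then show ?thesis using \<open>b \<notin> ?F\<close> by auto
  qed
  show "a = pt 0 1 \<longleftrightarrow> b = pt 0 1" if "{a, b} \<in> L"
    using key[of a] key[of b] that by (auto simp: insert_commute)
qed

text \<open>The Buchsbaum property speaks of vertex links only, so the obstruction is placed inside
  one: 4 belongs to \<open>obstruction\<close> for every \<open>m\<close>, and the link of the
  obstruction is an iterated link within that of \<open>pt 0 4\<close>.\<close>

lemma not_CM_link:
  fixes K :: "'k::field itself"
  assumes "m \<notin> {3, 4, 5, 7}"
  shows "\<not> complex_CM K (link \<Delta> {pt 0 4})"
proof
  assume CM: "complex_CM K (link \<Delta> {pt 0 4})"
  note ob = obstruction_link[OF assms]
  let ?F = "pt 0 ` obstruction"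
  have "pt 0 4 \<in> ?F" unfolding obstruction_def by blast
  then have union: "{pt 0 4} \<union> (?F - {pt 0 4}) = ?F" by blast
  have F: "link \<Delta> ?F = link (link \<Delta> {pt 0 4}) (?F - {pt 0 4})"
    by (subst link_link[OF finite_complex_\<Delta>]) (simp, simp only: union)
  have "?F - {pt 0 4} \<in> \<Delta>" using finite_complexD(3)[OF finite_complex_\<Delta> ob(1)] by blast
  then have "?F - {pt 0 4} \<in> link \<Delta> {pt 0 4}"
    using ob(1) union unfolding link_def by (simp add: Un_commute)
  then have "complex_CM K (link \<Delta> ?F)"
    unfolding F using complex_CM_link[OF finite_complex_link[OF finite_complex_\<Delta>] CM] by blast
  moreover have "\<not> complex_CM K (link \<Delta> ?F)"
    by (rule not_CM_if_separated[OF finite_complex_link[OF finite_complex_\<Delta>], where P = "\<lambda>a. a = pt 0 1"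
        and u = "pt 0 1" and v = "pt 0 0" and F = "{pt 0 0, pt 0 2}"])
      (use ob m_ge_3 l_pos pt_eq_iff[of 0 0 0 1] in auto)
  ultimately show False by blast
qed

lemma not_S2_obstruction:
  assumes "m \<notin> {3, 4, 5, 7}"
  shows "\<not> complex_S2 \<Delta>"
proof
  assume S2: "complex_S2 \<Delta>"
  note ob = obstruction_link[OF assms]
  let ?L = "link \<Delta> (pt 0 ` obstruction)"
  have "1 \<le> cdim ?L" using cdim_ge[OF finite_complex_link[OF finite_complex_\<Delta>] ob(2)] ob(5) by simp
  then have "complex_connected ?L" using S2 ob(1) unfolding complex_S2_def by blast
  moreover have "\<not> complex_connected ?L"
    by (rule not_connected_if_separated[where P = "\<lambda>a. a = pt 0 1" and u = "pt 0 1" and v = "pt 0 0"])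
      (use ob m_ge_3 l_pos pt_eq_iff[of 0 0 0 1] in auto)
  ultimately show False by blast
qed

lemma face_pair:
  assumes "4 \<le> m" "r < l"
  shows "{pt r 0, pt r 2} \<in> \<Delta>" "card {pt r 0, pt r 2} = 2"
proof -
  have "cyc_indep m {0, 2}" using assms unfolding cyc_indep_def by (auto simp: Suc_mod_cases)
  then show "{pt r 0, pt r 2} \<in> \<Delta>" using indep_pt[OF assms(2), of "{0, 2}" 0] assms(1) by simp
  show "card {pt r 0, pt r 2} = 2" using pt_eq_iff[OF assms(2,2), of 0 2] assms(1) by auto
qed

text \<open>The residue modulo \<open>l\<close> is constant on faces. Dimension 1 is the smallest in
  which Cohen--Macaulayness of a skeleton forbids this, and \<open>4 \<le> m\<close> provides edges
  in each copy.\<close>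

lemma join_disconnected:
  fixes K :: "'k::field itself"
  assumes "2 \<le> l" "4 \<le> m"
  shows "\<not> complex_CM K \<Delta>" "\<not> complex_CM K (pure_skeleton \<Delta> 1)" "\<not> complex_connected \<Delta>"
proof -
  have l: "0 < l" "1 < l" using assms by auto
  note e = face_pair[OF assms(2) l(1)] face_pair[OF assms(2) l(2)]
  have inv: "{a, b} \<in> \<Delta> \<Longrightarrow> (a mod l = 0) = (b mod l = 0)" for a b
    using same_copy[of "{a, b}" a b] by simp
  have v: "pt 0 0 mod l = 0" "pt 1 0 mod l \<noteq> 0" using pt_mod[OF l(1)] pt_mod[OF l(2)] by auto
  have skel: "{pt 0 0, pt 0 2} \<in> pure_skeleton \<Delta> 1" "{pt 1 0, pt 1 2} \<in> pure_skeleton \<Delta> 1"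
    using pure_skeletonI[where i = 1, OF e(1) _ order_refl, unfolded e(2)]
      pure_skeletonI[where i = 1, OF e(3) _ order_refl, unfolded e(4)] by simp_all
  note fc = finite_complex_pure_skeleton[OF finite_complex_\<Delta>]
  show "\<not> complex_CM K \<Delta>"
    by (rule not_CM_if_separated[where P = "\<lambda>a. a mod l = 0", OF finite_complex_\<Delta> inv UnionI[OF e(1), of "pt 0 0"] UnionI[OF e(3), of "pt 1 0"] v e(1)])
      (simp_all add: e)
  show "\<not> complex_CM K (pure_skeleton \<Delta> 1)"
    by (rule not_CM_if_separated[where P = "\<lambda>a. a mod l = 0", OF fc(1) inv UnionI[OF skel(1), of "pt 0 0"] UnionI[OF skel(2), of "pt 1 0"] v skel(1)])
      (use fc(2) in \<open>auto simp: e\<close>)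
  show "\<not> complex_connected \<Delta>"
    by (rule not_connected_if_separated[where P = "\<lambda>a. a mod l = 0", OF inv UnionI[OF e(1), of "pt 0 0"] UnionI[OF e(3), of "pt 1 0"] v]) simp_all
qed

lemma face_iff_l_1: "l = 1 \<Longrightarrow> F \<in> \<Delta> \<longleftrightarrow> cyc_indep m F"
proof -
  assume l: "l = 1"
  have pt: "pt 0 i = i" if "i < m" for i using that l unfolding pt_def by simp
  have "F \<in> \<Delta> \<longleftrightarrow> cyc_indep m F" if "F \<subseteq> {..<m}"
  proof -
    have "(\<lambda>i. pt 0 (0 + i)) ` F = id ` F" by (rule image_cong) (use that pt in auto)
    then show ?thesis using indep_pt[of 0 F 0] that l by simp
  qed
  moreover have "F \<subseteq> {..<m}" if "F \<in> \<Delta>" using face_less[OF that] l by auto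
  ultimately show ?thesis unfolding cyc_indep_def by blast
qed

lemma even_cycle_skeleton_not_CM:
  fixes K :: "'k::field itself"
  assumes l: "l = 1" and m: "even m"
  shows "\<not> complex_CM K (pure_skeleton \<Delta> (int (m div 2) - 1))"
proof -
  let ?D = "pure_skeleton \<Delta> (int (m div 2) - 1)"
  obtain n where n: "m = 2 * n" using m by blast
  have n2: "2 \<le> n" using m_ge_3 n by simp
  have D: "finite_complex ?D" using finite_complex_pure_skeleton[OF finite_complex_\<Delta>] by blast
  have face: "(\<lambda>t. 2 * t + s) ` {..<n} \<in> ?D" if s: "s \<le> 1" for s
  proof (rule pure_skeletonI[OF _ _ order_refl])
    have "Suc (2 * t + s) mod (2 * n) \<noteq> 2 * t' + s" if "t < n" for t t'
    proof -
      have "odd (Suc (2 * t + s) mod (2 * n)) \<longleftrightarrow> odd (Suc (2 * t + s))"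
        by (metis dvd_mod_iff dvd_triv_left)
      then show ?thesis by (metis even_Suc even_add even_mult_iff even_numeral)
    qed
    then have "cyc_indep (2 * n) ((\<lambda>t. 2 * t + s) ` {..<n})"
      unfolding cyc_indep_def using s by auto
    then show "(\<lambda>t. 2 * t + s) ` {..<n} \<in> \<Delta>"
      using face_iff_l_1[OF l] n by simp
    have "card ((\<lambda>t. 2 * t + s) ` {..<n}) = n" by (simp add: card_image inj_on_def)
    then show "int (card ((\<lambda>t. 2 * t + s) ` {..<n})) = int (m div 2) - 1 + 1" using n by simp
  qed
  \<comment> \<open>By \<open>cyc_extremal_uncovered\<close> a change of parity within a facet would
    make \<open>m\<close> odd.\<close>
  have inv: "even a = even b" if ab: "{a, b} \<in> ?D" for a b
  proof -
    obtain I where I: "{a, b} \<subseteq> I" "I \<in> \<Delta>" "card I = m div 2"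
      using ab unfolding pure_skeleton_def faces_of_dim_def by auto
    then have "cyc_indep m I" using face_iff_l_1[OF l] by blast
    then show ?thesis
      using cyc_extremal_uncovered(1)[of m I a b] cyc_extremal_uncovered(1)[of m I b a] I m
      by (metis insert_subset linorder_neqE_nat)
  qed
  have v: "0 \<in> \<Union>?D" "1 \<in> \<Union>?D"
    using n2 by (intro UnionI[OF face[of 0]] UnionI[OF face[of 1]] image_eqI[of _ _ 0]; simp)+
  show ?thesis
    by (rule not_CM_if_separated[OF D inv v _ _ face[of 0]])
      (use n2 in \<open>auto simp: card_image inj_on_def\<close>)
qed

lemma cyc_skeleton_odd_cycle:
  assumes l: "l = 1" and m: "m = 2 * p + 1" and p: "2 \<le> p"
  shows "odd_cycle_complex (pure_skeleton \<Delta> (int p - 1)) p"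
proof
  let ?D = "pure_skeleton \<Delta> (int p - 1)"
  note fc = finite_complex_pure_skeleton[OF finite_complex_\<Delta>, of "int p - 1"]
  show "finite_complex ?D" by (rule fc)
  show "2 \<le> p" by (rule p)
  have "v < m" if "v \<in> \<Union>?D" for v using that fc(2) face_less l by fastforce
  then show "\<Union>?D \<subseteq> {..2 * p}" using m by force
  have zz: "e \<in> ?D" if "e \<subseteq> zigzag p s k" "s \<le> 1" for e s k
    by (rule pure_skeletonI[OF _ _ that(1)])
      (use face_iff_l_1[OF l] cyc_indep_zigzag[OF that(2), of p k] m in \<open>auto simp: card_zigzag\<close>)
  show "{i, i + 2} \<in> ?D" if "i + 2 \<le> 2 * p" for i using zigzag_edges(1)[OF p that] zz by blast
  show "{1, 2 * p} \<in> ?D" "{0, 2 * p - 1} \<in> ?D" using zigzag_edges(2,3)[OF p] zz by force+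
qed

lemma odd_cycle_skeleton_not_CM:
  fixes K :: "'k::field itself"
  assumes l: "l = 1" and m: "m = 2 * p + 1" and p: "3 \<le> p"
  shows "\<not> complex_CM K (pure_skeleton \<Delta> (int p - 1))"
proof
  let ?D = "pure_skeleton \<Delta> (int p - 1)"
  assume CM: "complex_CM K ?D"
  interpret odd_cycle_complex ?D p using cyc_skeleton_odd_cycle[OF l m] p by simp
  have "zigzag p 0 0 \<in> ?D"
    by (rule pure_skeletonI[OF _ _ order_refl])
      (use face_iff_l_1[OF l] cyc_indep_zigzag[of 0 p 0] m in \<open>auto simp: card_zigzag\<close>)
  \<comment> \<open>This is where \<open>3 \<le> p\<close> enters. For \<open>p = 2\<close> the
    complex is a circle, and degree 1 is its top degree, on which Cohen--Macaulayness puts no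
    condition.\<close>
  then have "1 < cdim ?D" using cdim_ge[OF D] p by (fastforce simp: card_zigzag)
  moreover have "{} \<in> ?D" using wrap_edge(1) finite_complexD(3)[OF D] by blast
  ultimately have "reduced_homology_vanishes K ?D 1" using CM unfolding complex_CM_def by force
  moreover have "\<not> reduced_homology_vanishes K ?D 1"
  proof (rule not_H1)
    fix a b c assume "{a, b, c} \<in> ?D" and abc: "a < b" "b < c" "even a \<noteq> even b"
    then obtain I where I: "{a, b, c} \<subseteq> I" "I \<in> \<Delta>" "card I = p"
      unfolding pure_skeleton_def faces_of_dim_def by auto
    then have "cyc_indep m I" using face_iff_l_1[OF l] by blast
    then show "even b = even c"
      using cyc_extremal_no_alternating_triple[of m I a b c] I m abc by simp
  qed
  ultimately show False by blast
qed

end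

section \<open>The small cycles\<close>

lemma vd_indep_complex_step:
  assumes "symp E" "irreflp E" "well_covered V E" "x \<in> V"
    and "vertex_decomposable (indep_complex (V - closed_nbhd V E x) E)"
    and "vertex_decomposable (indep_complex (V - {x}) E)"
  shows "vertex_decomposable (indep_complex V E)"
proof (rule vertex_decomposable.shedding[of _ x])
  show "{x} \<in> indep_complex V E"
    using assms(4) irreflpD[OF assms(2)] unfolding indep_complex_def independent_def by simp
qed (use assms in \<open>simp_all add: pure_indep_complex deletion_indep_complex link_indep_complex\<close>)

lemma vd_indep_complex_edgeless:
  assumes "finite V" "independent E V"
  shows "vertex_decomposable (indep_complex V E)"
proof (rule vertex_decomposable.simplex)
  have "indep_complex V E = Pow V" using assms(2) unfolding indep_complex_def independent_def by auto
  then show "is_simplex (indep_complex V E)" unfolding is_simplex_def using assms(1) by blast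
  show "pure (indep_complex V E)"
    using assms(2) unfolding pure_indep_complex well_covered_def maximal_independent_def by blast
qed

lemma indep_complex_complete:
  assumes "irreflp E" "\<And>a b. a \<in> V \<Longrightarrow> b \<in> V \<Longrightarrow> a \<noteq> b \<Longrightarrow> E a b" "V \<noteq> {}"
  shows "facets (indep_complex V E) = (\<lambda>v. {v}) ` V" "well_covered V E"
proof -
  have *: "maximal_independent V E I \<longleftrightarrow> (\<exists>v\<in>V. I = {v})" for I
  proof
    assume I: "maximal_independent V E I"
    then have I': "I \<subseteq> V" "\<And>a b. a \<in> I \<Longrightarrow> b \<in> I \<Longrightarrow> \<not> E a b"
      unfolding maximal_independent_def independent_def by simp_all
    then have sub: "a = b" if "a \<in> I" "b \<in> I" for a b using assms(2) that by (meson subsetD)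
    have "I \<noteq> {}"
    proof
      assume "I = {}"
      obtain v where v: "v \<in> V" using assms(3) by blast
      have "independent E {v}" using irreflpD[OF assms(1)] unfolding independent_def by blast
      then show False using I v \<open>I = {}\<close> unfolding maximal_independent_def by blast
    qed
    then show "\<exists>v\<in>V. I = {v}" using sub I'(1) by blast
  next
    assume "\<exists>v\<in>V. I = {v}"
    then obtain v where v: "v \<in> V" "I = {v}" by blast
    show "maximal_independent V E I" unfolding maximal_independent_def v(2)
    proof (intro conjI allI impI)
      show "independent E {v}" using irreflpD[OF assms(1)] unfolding independent_def by blast
      fix J assume "{v} \<subseteq> J \<and> J \<subseteq> V \<and> independent E J"
      then show "J = {v}" using assms(2) unfolding independent_def by blast
    qed (use v in simp)
  qed
  then show "facets (indep_complex V E) = (\<lambda>v. {v}) ` V" unfolding facets_indep_complex by auto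
  show "well_covered V E" unfolding well_covered_def * by auto
qed

text \<open>The complex is a set of points: deleting one leaves fewer points, and its link is
  \<open>{{}}\<close>, the simplex on no vertices.\<close>

lemma vd_indep_complex_complete:
  assumes "finite V" "V \<noteq> {}" "symp E" "irreflp E"
    and "\<And>a b. a \<in> V \<Longrightarrow> b \<in> V \<Longrightarrow> a \<noteq> b \<Longrightarrow> E a b"
  shows "vertex_decomposable (indep_complex V E)"
  using assms(1,2,5)
proof (induction V rule: finite_ne_induct)
  case (singleton x)
  show ?case
    by (rule vd_indep_complex_edgeless) (use irreflpD[OF assms(4)] in \<open>auto simp: independent_def\<close>)
next
  case (insert x V)
  have nbhd: "insert x V - closed_nbhd (insert x V) E x = {}"
    using insert unfolding closed_nbhd_def by auto
  have "vertex_decomposable (indep_complex (insert x V - closed_nbhd (insert x V) E x) E)"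
    unfolding nbhd by (rule vd_indep_complex_edgeless) (simp_all add: independent_def)
  moreover have "insert x V - {x} = V" using insert by simp
  moreover have "well_covered (insert x V) E"
    by (rule indep_complex_complete(2)[OF assms(4) insert.prems]) simp_all
  moreover have "vertex_decomposable (indep_complex V E)"
    by (rule insert.IH) (rule insert.prems, simp_all)
  ultimately show ?case
    using vd_indep_complex_step[OF assms(3,4), of "insert x V" x] by (simp only: insertI1)
qed

lemma shellable_indep_complex_complete:
  assumes "finite V" "V \<noteq> {}" "irreflp E"
    and "\<And>a b. a \<in> V \<Longrightarrow> b \<in> V \<Longrightarrow> a \<noteq> b \<Longrightarrow> E a b"
  shows "shellable (indep_complex V E)"
proof -
  note c = indep_complex_complete[OF assms(3,4,2)]
  obtain xs where xs: "set xs = V" "distinct xs" using finite_distinct_list[OF assms(1)] by blast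
  let ?Fs = "map (\<lambda>v. {v}) xs"
  have "\<exists>x\<in>?Fs ! i - ?Fs ! j. \<exists>k<i. ?Fs ! i - ?Fs ! k = {x}" if "i < length ?Fs" "j < i" for i j
  proof -
    have "xs ! i \<noteq> xs ! j" using that xs(2) by (auto simp: nth_eq_iff_index_eq)
    then have "?Fs ! i - ?Fs ! j = {xs ! i}" using that by auto
    then show ?thesis using that(2) by blast
  qed
  moreover have "distinct ?Fs" using xs(2) by (simp add: distinct_map inj_on_def)
  moreover have "set ?Fs = facets (indep_complex V E)" using c(1) xs(1) by simp
  ultimately show ?thesis unfolding shellable_def pure_indep_complex using c(2) by blast
qed

text \<open>Among the pure skeletons of a graph only the one of dimension 1 contains edges, so
  connectedness has to be checked only there.\<close>

lemma pure_skeleton_edge: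
  assumes "F \<in> pure_skeleton D i" "\<And>G. G \<in> D \<Longrightarrow> card G \<le> 2" "card F = 2" "finite_complex D"
  shows "i = 1"
proof -
  obtain G where G: "F \<subseteq> G" "G \<in> D" "int (card G) = i + 1"
    using assms(1) unfolding pure_skeleton_def faces_of_dim_def by blast
  have "card F \<le> card G" using card_mono[OF finite_complexD(2)[OF assms(4) G(2)] G(1)] .
  then show ?thesis using G(3) assms(2)[OF G(2)] assms(3) by simp
qed

section \<open>Well-coveredness, Buchsbaum, (sequential) Cohen--Macaulayness and S2\<close>

context cycle_join
begin

abbreviation "CM_parameters \<equiv> (l = 1 \<and> m \<in> {3, 5}) \<or> (2 \<le> l \<and> m = 3)"

lemma well_covered_iff: "well_covered {..<l * m} adj \<longleftrightarrow> m \<in> {3, 4, 5, 7}"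
proof
  assume "m \<in> {3, 4, 5, 7}"
  then have "pure \<Delta>" unfolding pure_def using facet_card by simp
  then show "well_covered {..<l * m} adj" unfolding \<Delta>_def pure_indep_complex .
qed (use not_well_covered in blast)

text \<open>For these \<open>m\<close> all facets have equal size, so \<open>\<Delta>\<close> is its
  own top skeleton and contains the closed walk.\<close>

lemma \<Delta>_connected:
  assumes "l = 1" "m \<in> {5, 7}"
  shows "complex_connected \<Delta>"
proof -
  define p where "p = m div 2"
  have p: "m = 2 * p + 1" "2 \<le> p" using assms(2) unfolding p_def by auto
  have "pure_skeleton \<Delta> (int p - 1) = \<Delta>"
    by (rule pure_skeleton_top[OF finite_complex_\<Delta>]) (use facet_card assms(2) p_def in auto)
  then interpret odd_cycle_complex \<Delta> p using cyc_skeleton_odd_cycle[OF assms(1) p] by simp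
  show ?thesis by (rule connected)
qed

text \<open>With \<open>x\<close> rotated to coordinate 0, the link is the path 4, 2, 5, 3 on the
  vertices of the same copy outside the closed neighbourhood of \<open>x\<close>.\<close>

lemma vertex_link_connected:
  assumes "m = 7" "{x} \<in> \<Delta>"
  shows "complex_connected (link \<Delta> {x})"
proof -
  define r where "r = x mod l"
  define k where "k = x div l"
  have r: "r < l" unfolding r_def using l_pos by simp
  have x: "x = pt r k" unfolding r_def k_def using pt_surj face_less[OF assms(2)] by simp
  let ?h = "\<lambda>i. pt r (k + i)"
  have edge: "{?h i, ?h j} \<in> link \<Delta> {x}" if "cyc_indep 7 {0, i, j}" "i \<noteq> 0" "j \<noteq> 0" for i j
  proof -
    have "?h ` {0, i, j} \<in> \<Delta>" using indep_pt[OF r, of "{0, i, j}" k] that(1) assms(1)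
      unfolding cyc_indep_def by simp
    then have f: "{?h i, ?h j} \<union> {x} \<in> \<Delta>" unfolding x by (simp add: insert_commute)
    then have "{?h i, ?h j} \<in> \<Delta>" by (rule finite_complexD(3)[OF finite_complex_\<Delta>]) blast
    moreover have "?h i \<noteq> x" "?h j \<noteq> x" unfolding x using that assms(1)
      pt_eq_iff[OF r r, of "k + i" "k + 0"] pt_eq_iff[OF r r, of "k + j" "k + 0"]
      mod_add_left_cancel_nat[of k _ 7 0]
      unfolding cyc_indep_def by auto
    ultimately show ?thesis using f unfolding link_def by auto
  qed
  let ?R = "\<lambda>a b. {a, b} \<in> link \<Delta> {x}"
  have e: "?R (?h 4) (?h 2)" "?R (?h 2) (?h 5)" "?R (?h 5) (?h 3)"
    by (intro edge; simp add: cyc_indep_def)+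
  have 2: "?R\<^sup>*\<^sup>* (?h 4) (?h 2)" using e(1) by (rule r_into_rtranclp)
  have 5: "?R\<^sup>*\<^sup>* (?h 4) (?h 5)" using 2 e(2) by (rule rtranclp.rtrancl_into_rtrancl)
  have 3: "?R\<^sup>*\<^sup>* (?h 4) (?h 3)" using 5 e(3) by (rule rtranclp.rtrancl_into_rtrancl)
  from 2 5 3 have reach: "?R\<^sup>*\<^sup>* (?h 4) (?h j)" if "j \<in> {2, 3, 4, 5}" for j
    using that by (elim insertE emptyE) simp_all
  show ?thesis
  proof (rule complex_connectedI)
    fix v assume "v \<in> \<Union>(link \<Delta> {x})"
    then obtain H where H: "v \<in> H" "x \<notin> H" "H \<union> {x} \<in> \<Delta>" unfolding link_def by blast
    have v: "v \<noteq> x" "{v, x} \<in> \<Delta>"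
      using H finite_complexD(3)[OF finite_complex_\<Delta> H(3), of "{v, x}"] by auto
    have "pt r k \<in> {v, x}" using x by simp
    then obtain I where I: "cyc_indep m I" "0 \<in> I" "{v, x} = ?h ` I"
      using face_obtain[OF v(2) _ r] by metis
    then obtain i where i: "i \<in> I" "v = ?h i" by blast
    have S: "i < 7" "Suc 0 mod 7 \<notin> I" "Suc i mod 7 \<notin> I"
      using I(1,2) i(1) assms(1) unfolding cyc_indep_def by blast+
    then have "Suc i mod 7 \<noteq> 0" using I(2) by metis
    moreover have "i \<noteq> 0" using v(1) i(2) x by (metis add_0_right)
    moreover have "i \<noteq> 1" "i \<noteq> 6" using i(1) S(2) calculation by auto
    ultimately have "i \<in> {2, 3, 4, 5}" using S(1) by auto
    then show "?R\<^sup>*\<^sup>* (?h 4) v" unfolding i(2) by (rule reach)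
  qed
qed

lemma Buchsbaum_iff:
  fixes K :: "'k::field itself"
  shows "graph_Buchsbaum K {..<l * m} adj \<longleftrightarrow> m \<in> {3, 4, 5, 7}"
proof -
  have "graph_Buchsbaum K {..<l * m} adj \<longleftrightarrow> (\<forall>x<l * m. complex_CM K (link \<Delta> {x}))"
    unfolding graph_Buchsbaum_iff[OF symp_adj irreflp_adj] \<Delta>_def by auto
  also have "\<dots> \<longleftrightarrow> m \<in> {3, 4, 5, 7}"
  proof
    assume "\<forall>x<l * m. complex_CM K (link \<Delta> {x})"
    then have "complex_CM K (link \<Delta> {pt 0 4})" using pt_less l_pos by simp
    then show "m \<in> {3, 4, 5, 7}" using not_CM_link by blast
  next
    assume m: "m \<in> {3, 4, 5, 7}"
    show "\<forall>x<l * m. complex_CM K (link \<Delta> {x})"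
    proof (intro allI impI)
      fix x assume x: "x < l * m"
      have "{x} \<in> \<Delta>" using x irreflpD[OF irreflp_adj]
        unfolding \<Delta>_def indep_complex_def independent_def by simp
      have card: "card H + 1 \<le> m div 2" if "H \<in> link \<Delta> {x}" for H
        using link_card_le[OF finite_complex_\<Delta> face_card_le that] by simp
      show "complex_CM K (link \<Delta> {x})"
      proof (rule CM_if_connected_graph[OF finite_complex_link[OF finite_complex_\<Delta>]])
        fix H assume H: "H \<in> link \<Delta> {x}"
        show "card H \<le> 2" using card[OF H] m by auto
        assume "card H = 2"
        then have "m = 7" using card[OF H] m by auto
        then show "complex_connected (link \<Delta> {x})" using vertex_link_connected \<open>{x} \<in> \<Delta>\<close> by blast
      qed
    qed
  qed
  finally show ?thesis .
qed

lemma skeleton_CM: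
  fixes K :: "'k::field itself"
  assumes CM_parameters
  shows "complex_CM K (pure_skeleton \<Delta> i)"
proof -
  note fc = finite_complex_pure_skeleton[OF finite_complex_\<Delta>]
  have le: "card F \<le> 2" if "F \<in> \<Delta>" for F using face_card_le[OF that] assms by auto
  show ?thesis
  proof (rule CM_if_connected_graph[OF fc(1)])
    fix F assume F: "F \<in> pure_skeleton \<Delta> i"
    then have "F \<in> \<Delta>" using fc(2) by blast
    then show "card F \<le> 2" by (rule le)
    assume card: "card F = 2"
    then have m: "m = 5" "l = 1" using face_card_le[OF \<open>F \<in> \<Delta>\<close>] assms by auto
    have "i = 1" using pure_skeleton_edge[OF F le card finite_complex_\<Delta>] .
    moreover have "pure_skeleton \<Delta> 1 = \<Delta>"
      by (rule pure_skeleton_top[OF finite_complex_\<Delta>]) (use facet_card m in auto)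
    ultimately show "complex_connected (pure_skeleton \<Delta> i)" using \<Delta>_connected m by simp
  qed
qed

lemma SCM_iff:
  fixes K :: "'k::field itself"
  shows "complex_SCM K \<Delta> \<longleftrightarrow> CM_parameters"
proof
  assume SCM: "complex_SCM K \<Delta>"
  show CM_parameters
  proof (rule ccontr)
    assume np: "\<not> CM_parameters"
    show False
    proof (cases "2 \<le> l")
      case True
      then have "4 \<le> m" using np m_ge_3 by linarith
      then show False using join_disconnected(2)[OF True] SCM unfolding complex_SCM_def by blast
    next
      case False
      then have l: "l = 1" using l_pos by simp
      have "even m"
      proof (rule ccontr)
        assume "odd m"
        then obtain p where p: "m = 2 * p + 1" by (rule oddE)
        have "p \<noteq> 1" "p \<noteq> 2" using np l p by auto
        then have "3 \<le> p" using m_ge_3 p by linarith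
        then show False using odd_cycle_skeleton_not_CM[OF l p] SCM unfolding complex_SCM_def by blast
      qed
      then show False using even_cycle_skeleton_not_CM[OF l] SCM unfolding complex_SCM_def by blast
    qed
  qed
qed (simp only: complex_SCM_def skeleton_CM simp_thms)

text \<open>Vertex links restrict \<open>m\<close> first. For the remaining \<open>m\<close> all
  facets have equal size, \<open>\<Delta>\<close> equals its top skeleton, and the results on
  skeletons carry over.\<close>

lemma CM_iff:
  fixes K :: "'k::field itself"
  shows "complex_CM K \<Delta> \<longleftrightarrow> CM_parameters"
proof -
  have skel: "pure_skeleton \<Delta> (int (m div 2) - 1) = \<Delta>" if "m \<in> {3, 4, 5, 7}"
    by (rule pure_skeleton_top[OF finite_complex_\<Delta>]) (simp add: facet_card[OF that])
  show ?thesis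
  proof
    assume CM: "complex_CM K \<Delta>"
    have pt: "{pt 0 4} \<in> \<Delta>" using pt_less[of 0 4] l_pos irreflpD[OF irreflp_adj]
      unfolding \<Delta>_def indep_complex_def independent_def by simp
    have m: "m \<in> {3, 4, 5, 7}"
      using not_CM_link complex_CM_link[OF finite_complex_\<Delta> CM pt] by blast
    show CM_parameters
    proof (rule ccontr)
      assume np: "\<not> CM_parameters"
      show False
      proof (cases "2 \<le> l")
        case True
        then have "4 \<le> m" using np m_ge_3 by linarith
        then show False using join_disconnected(1)[OF True] CM by blast
      next
        case False
        then have l: "l = 1" using l_pos by simp
        then consider "m = 4" | "m = 7" using m np by auto
        then show False
        proof cases
          case 1
          then show False using even_cycle_skeleton_not_CM[OF l, of K] skel CM by simp
        next
          case 2
          then show False using odd_cycle_skeleton_not_CM[OF l, of 3 K] skel CM by simp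
        qed
      qed
    qed
  next
    assume CM_parameters
    then show "complex_CM K \<Delta>" using skel skeleton_CM[of K "int (m div 2) - 1"] by auto
  qed
qed

lemma not_connected_cases:
  assumes "m = 4 \<or> (2 \<le> l \<and> 4 \<le> m)"
  shows "\<not> complex_connected \<Delta>"
proof (cases "2 \<le> l")
  case True
  then show ?thesis using join_disconnected(3) assms by auto
next
  case False
  then have l: "l = 1" and m: "m = 4" using l_pos assms by auto
  have inv: "even a = even b" if "{a, b} \<in> \<Delta>" for a b
  proof (rule ccontr)
    assume "even a \<noteq> even b"
    moreover have "a < 4" "b < 4" using face_less[OF that] l m by auto
    then have "a \<in> {0, 1, 2, 3}" "b \<in> {0, 1, 2, 3}" by auto
    ultimately have "Suc a mod 4 = b \<or> Suc b mod 4 = a"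
      by (elim insertE emptyE) simp_all
    then show False using that m unfolding face_iff_l_1[OF l] cyc_indep_def by auto
  qed
  have "{0} \<in> \<Delta>" "{1} \<in> \<Delta>" using m unfolding face_iff_l_1[OF l] cyc_indep_def by auto
  then show ?thesis
    by (intro not_connected_if_separated[where P = even and u = 0 and v = 1]) (auto simp: inv)
qed

lemma S2_iff: "complex_S2 \<Delta> \<longleftrightarrow> (l = 1 \<and> m \<in> {3, 5, 7}) \<or> (2 \<le> l \<and> m = 3)"
proof
  assume S2: "complex_S2 \<Delta>"
  have m: "m \<in> {3, 4, 5, 7}" using not_S2_obstruction S2 by blast
  show "(l = 1 \<and> m \<in> {3, 5, 7}) \<or> (2 \<le> l \<and> m = 3)"
  proof (rule ccontr)
    assume "\<not> ?thesis"
    then have c: "m = 4 \<or> (2 \<le> l \<and> 4 \<le> m)" using m l_pos by auto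
    have e: "{pt 0 0, pt 0 2} \<in> \<Delta>" "card {pt 0 0, pt 0 2} = 2" using face_pair[of 0] c l_pos by auto
    then have "1 \<le> cdim \<Delta>" using cdim_ge[OF finite_complex_\<Delta> e(1)] by simp
    moreover have "{} \<in> \<Delta>" using finite_complexD(3)[OF finite_complex_\<Delta> e(1)] by blast
    ultimately have "complex_connected \<Delta>" using S2 unfolding complex_S2_def by fastforce
    then show False using not_connected_cases[OF c] by blast
  qed
next
  assume pos7: "(l = 1 \<and> m \<in> {3, 5, 7}) \<or> (2 \<le> l \<and> m = 3)"
  show "complex_S2 \<Delta>" unfolding complex_S2_def
  proof (intro ballI impI)
    fix F assume F: "F \<in> \<Delta>" and dim: "1 \<le> cdim (link \<Delta> F)"
    obtain H where H: "H \<in> link \<Delta> F" "cdim (link \<Delta> F) = int (card H) - 1"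
      using cdim_attained[OF finite_complex_link[OF finite_complex_\<Delta>]] empty_in_link[OF F finite_complex_\<Delta>]
      by (metis empty_iff)
    \<comment> \<open>A link of positive dimension contains an edge disjoint from \<open>F\<close>.
      This leaves the whole complex and, for \<open>m = 7\<close>, the vertex links.\<close>
    have "2 + card F \<le> m div 2" using link_card_le[OF finite_complex_\<Delta> face_card_le H(1)] H(2) dim by linarith
    then have c: "m = 5 \<and> card F = 0 \<or> m = 7 \<and> card F \<le> 1" "l = 1" using pos7 by auto
    show "complex_connected (link \<Delta> F)"
    proof (cases "card F = 0")
      case True
      then have "F = {}" using finite_complexD(2)[OF finite_complex_\<Delta> F] by simp
      then show ?thesis using \<Delta>_connected c by auto
    next
      case False
      then have "m = 7" "card F = 1" using c by auto
      then show ?thesis using vertex_link_connected F by (metis card_1_singletonE)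
    qed
  qed
qed

end

section \<open>Vertex decomposability and shellability\<close>

lemma well_coveredI:
  assumes "symp E" "irreflp E"
    and "\<forall>I\<in>Pow V. independent E I \<and> (\<forall>y\<in>V. y \<in> I \<or> (\<exists>x\<in>I. E x y)) \<longrightarrow> card I = n"
  shows "well_covered V E"
  using assms(3) unfolding well_covered_def maximal_independent_iff[OF assms(1,2)] by simp

lemma closed_nbhd_insert:
  "closed_nbhd {} E x = {x}"
  "closed_nbhd (insert a V) E x = (if E x a then insert a (closed_nbhd V E x) else closed_nbhd V E x)"
  unfolding closed_nbhd_def by auto

context cycle_join
begin

lemma adj_l_1: "l = 1 \<Longrightarrow> adj a b \<longleftrightarrow> a < m \<and> b < m \<and> (Suc a mod m = b \<or> Suc b mod m = a)"
  unfolding adj_def by auto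

lemma vd_5_cycle:
  assumes "l = 1" "m = 5"
  shows "vertex_decomposable \<Delta>"
proof -
  have adj: "adj a b \<longleftrightarrow> a < 5 \<and> b < 5 \<and> (Suc a mod 5 = b \<or> Suc b mod 5 = a)" for a b
    using adj_l_1 assms by simp
  note step = vd_indep_complex_step[OF symp_adj irreflp_adj]
  have V: "{..<l * m} = {0, 1, 2, 3, 4}" using assms by auto
  \<comment> \<open>Shedding 0, 2 and 3 in turn leaves the path 1, 2, 3, 4, then the vertex 1 beside
    the edge from 3 to 4, then two isolated vertices. From the path an inner vertex is shed, because
    without an end it would be a path on three vertices, which is not well-covered.\<close>
  have wc: "well_covered {0, 1, 2, 3, 4} adj" using well_covered_iff V assms by simp
  have wc1: "well_covered {1, 2, 3, 4} adj"
    by (rule well_coveredI[OF symp_adj irreflp_adj, of _ 2]) (simp add: Pow_insert ball_Un independent_def adj)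
  have wc2: "well_covered {1, 3, 4} adj"
    by (rule well_coveredI[OF symp_adj irreflp_adj, of _ 2]) (simp add: Pow_insert ball_Un independent_def adj)
  have d2: "{1, 3, 4} - closed_nbhd {1, 3, 4} adj 3 = {1}" "{1, 3, 4} - {3} = {1, 4 :: nat}"
    by (simp_all add: closed_nbhd_insert adj insert_Diff_if)
  have "vertex_decomposable (indep_complex {1, 3, 4} adj)"
    by (rule step[OF wc2, of 3]; (simp only: d2)?)
      (auto simp: adj independent_def intro!: vd_indep_complex_edgeless)
  moreover have d1: "{1, 2, 3, 4} - closed_nbhd {1, 2, 3, 4} adj 2 = {4}" "{1, 2, 3, 4} - {2} = {1, 3, 4 :: nat}"
    by (simp_all add: closed_nbhd_insert adj insert_Diff_if)
  moreover have "vertex_decomposable (indep_complex {4} adj)"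
    by (rule vd_indep_complex_edgeless) (auto simp: adj independent_def)
  ultimately have "vertex_decomposable (indep_complex {1, 2, 3, 4} adj)"
    using step[OF wc1, of 2] by simp
  moreover have d0: "{0, 1, 2, 3, 4} - closed_nbhd {0, 1, 2, 3, 4} adj 0 = {2, 3}" "{0, 1, 2, 3, 4} - {0} = {1, 2, 3, 4 :: nat}"
    by (simp_all add: closed_nbhd_insert adj insert_Diff_if)
  moreover have "vertex_decomposable (indep_complex {2, 3} adj)"
    by (rule vd_indep_complex_complete[OF _ _ symp_adj irreflp_adj]) (auto simp: adj)
  ultimately show ?thesis
    using step[OF wc, of 0] unfolding \<Delta>_def V by simp
qed

lemma facet_if_card:
  assumes "F \<in> \<Delta>" "card F = m div 2"
  shows "F \<in> facets \<Delta>"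
  unfolding facets_def
proof (intro CollectI conjI ballI impI assms(1))
  fix G assume "G \<in> \<Delta>" "F \<subseteq> G"
  then show "G = F"
    using card_seteq[OF finite_complexD(2)[OF finite_complex_\<Delta>], of G F] face_card_le[of G] assms(2) by simp
qed

lemma shellable_5_cycle:
  assumes l: "l = 1" and m: "m = 5"
  shows "shellable \<Delta>"
proof -
  \<comment> \<open>The independence complex of the 5-cycle is again a 5-cycle; its edges are listed
    in cyclic order.\<close>
  let ?Fs = "[{0, 2}, {2, 4}, {4, 1}, {1, 3}, {3, 0 :: nat}]"
  have m': "m \<in> {3, 4, 5, 7}" using m by simp
  have "set ?Fs = facets \<Delta>"
  proof
    show "set ?Fs \<subseteq> facets \<Delta>"
    proof
      fix F assume "F \<in> set ?Fs"
      then have "cyc_indep 5 F" "card F = 2" unfolding cyc_indep_def by auto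
      then show "F \<in> facets \<Delta>" using facet_if_card face_iff_l_1[OF l] m by simp
    qed
    show "facets \<Delta> \<subseteq> set ?Fs"
    proof
      fix F assume F: "F \<in> facets \<Delta>"
      then have "card F = 2" using facet_card[OF m'] m by simp
      then obtain a b where ab: "a < b" "F = {a, b}" by (rule card_2_linorder_obtain)
      have "cyc_indep 5 F" using facetsD[OF F] face_iff_l_1[OF l] m by simp
      then have "b < 5" "Suc a mod 5 \<noteq> b" "Suc b mod 5 \<noteq> a" using ab unfolding cyc_indep_def by auto
      moreover from this have "b \<in> {0, 1, 2, 3, 4}" by auto
      moreover have "a \<in> {0, 1, 2, 3, 4}" using ab(1) \<open>b < 5\<close> by auto
      ultimately show "F \<in> set ?Fs" using ab by (elim insertE emptyE) (simp_all add: insert_commute)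
    qed
  qed
  moreover have "pure \<Delta>" unfolding pure_def using facet_card[OF m'] by simp
  moreover have "distinct ?Fs" by (simp add: doubleton_eq_iff)
  moreover have "\<forall>i<length ?Fs. \<forall>j<i. \<exists>x\<in>?Fs ! i - ?Fs ! j. \<exists>k<i. ?Fs ! i - ?Fs ! k = {x}"
    by (simp add: numeral_eq_Suc All_less_Suc Ex_less_Suc insert_Diff_if)
  ultimately show ?thesis unfolding shellable_def by blast
qed

lemma cyc_indep_7_triple:
  assumes "cyc_indep 7 J" "0 \<in> J" "card J = 3"
  shows "J \<in> {{0, 2, 4}, {0, 2, 5}, {0, 3, 5}}"
proof -
  have S: "J \<subseteq> {..<7}" "\<And>i. i \<in> J \<Longrightarrow> Suc i mod 7 \<notin> J" using assms(1) unfolding cyc_indep_def by auto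
  have "1 \<notin> J" "6 \<notin> J" using S(2)[of 0] S(2)[of 6] assms(2) by auto
  moreover have "{..<7} = {0, 1, 2, 3, 4, 5, 6 :: nat}" by auto
  ultimately have "J - {0} \<in> Pow {2, 3, 4, 5}" using S(1) by auto
  moreover have "J = insert 0 (J - {0})" using assms(2) by blast
  moreover have "\<forall>K\<in>Pow {2, 3, 4, 5}. cyc_indep 7 (insert 0 K) \<and> card (insert 0 K) = 3 \<longrightarrow>
      insert 0 K \<in> {{0, 2, 4}, {0, 2, 5}, {0, 3, 5}}"
    by (simp add: Pow_insert ball_Un cyc_indep_def)
  ultimately show ?thesis using assms(1,3) by metis
qed

lemma facet_7_through:
  assumes "m = 7" "F \<in> facets \<Delta>" "pt r k \<in> F" "r < l"
  obtains J where "J \<in> {{0, 2, 4}, {0, 2, 5}, {0, 3, 5}}" "F = (\<lambda>i. pt r (k + i)) ` J"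
proof -
  obtain J where J: "cyc_indep m J" "0 \<in> J" "F = (\<lambda>i. pt r (k + i)) ` J"
    using face_obtain[OF facetsD[OF assms(2)] assms(3,4)] .
  have "card F = 3" using facet_card[OF _ assms(2)] assms(1) by simp
  moreover have "card F = card J" unfolding J(3) using card_pt_image[OF assms(4)] J(1) unfolding cyc_indep_def by blast
  ultimately show ?thesis using that cyc_indep_7_triple[of J] J assms(1) by simp
qed

text \<open>The gaps of a facet are 2, 2 and 3. Here \<open>pt r k\<close> is the vertex between the
  two gaps 2, which makes the facet the middle one of the three through that vertex: it shares an
  edge with each of the other two.\<close>

lemma facet_7_middle:
  assumes "m = 7" "F \<in> facets \<Delta>"
  obtains r k where "r < l" "F = {pt r k, pt r (k + 2), pt r (k + 5)}"
proof -
  have "F \<noteq> {}" using facet_card[OF _ assms(2)] assms(1) by auto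
  then obtain x where x: "x \<in> F" by blast
  define r k where "r = x mod l" and "k = x div l"
  have r: "r < l" unfolding r_def using l_pos by simp
  have "x = pt r k" unfolding r_def k_def using pt_surj face_less[OF facetsD[OF assms(2)] x] by simp
  then obtain J where J: "J \<in> {{0, 2, 4}, {0, 2, 5}, {0, 3, 5}}" "F = (\<lambda>i. pt r (k + i)) ` J"
    using facet_7_through[OF assms, of r k] r x by blast
  have wrap: "pt r (k + 7 + i) = pt r (k + i)" for i
    using mod_add_self2[of "k + i" m] unfolding pt_def by (simp add: assms(1) ac_simps)
  have "F = {pt r k, pt r (k + 2), pt r (k + 5)} \<or> F = {pt r (k + 2), pt r (k + 2 + 2), pt r (k + 2 + 5)}
    \<or> F = {pt r (k + 5), pt r (k + 5 + 2), pt r (k + 5 + 5)}"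
  proof -
    have w: "pt r (k + 2 + 2) = pt r (k + 4)" "pt r (k + 2 + 5) = pt r k"
      "pt r (k + 5 + 2) = pt r k" "pt r (k + 5 + 5) = pt r (k + 3)"
    proof -
      have "k + 2 + 2 = k + 4" "k + 2 + 5 = k + 7" "k + 5 + 2 = k + 7" "k + 5 + 5 = k + 7 + 3" by simp_all
      then show "pt r (k + 2 + 2) = pt r (k + 4)" "pt r (k + 2 + 5) = pt r k"
        "pt r (k + 5 + 2) = pt r k" "pt r (k + 5 + 5) = pt r (k + 3)"
        using wrap[of 0] wrap[of 3] by (simp_all only: add_0_right)
    qed
    show ?thesis unfolding w J(2) using J(1) by (elim insertE emptyE) (simp_all add: insert_commute)
  qed
  then show ?thesis using that[OF r] by blast
qed

text \<open>The last facet of a shelling would be the middle one of the three facets through one of its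
  vertices. The later of the other two then meets the earlier facets through that vertex in a
  single point.\<close>

lemma not_shellable_7_cycle:
  assumes m: "m = 7"
  shows "\<not> shellable \<Delta>"
proof
  assume "shellable \<Delta>"
  then obtain Fs where dist: "distinct Fs" and Fs: "set Fs = facets \<Delta>"
    and shell: "\<And>i j. i < length Fs \<Longrightarrow> j < i \<Longrightarrow>
      \<exists>x\<in>Fs ! i - Fs ! j. \<exists>k<i. Fs ! i - Fs ! k = {x}"
    unfolding shellable_def by blast
  have "{pt 0 0} \<in> \<Delta>" using indep_pt[of 0 "{0}" 0] l_pos m unfolding cyc_indep_def by simp
  then have "facets \<Delta> \<noteq> {}" using facet_above[OF finite_complex_\<Delta>] by blast
  then have ne: "Fs \<noteq> []" using Fs by auto
  let ?n = "length Fs - 1"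
  obtain r k where r: "r < l" and L: "Fs ! ?n = {pt r k, pt r (k + 2), pt r (k + 5)}"
    using facet_7_middle[OF m, of "Fs ! ?n"] Fs ne by (metis diff_less length_greater_0_conv less_one nth_mem)
  let ?h = "\<lambda>i. pt r (k + i)"
  have inj: "?h i = ?h j \<longleftrightarrow> i = j" if "i < 7" "j < 7" for i j
    using inj_on_eq_iff[OF inj_on_pt[OF r, of k], of i j] that m by simp
  have fac: "?h ` J \<in> facets \<Delta>" if "J = {0, 2, 4} \<or> J = {0, 3, 5}" for J
  proof (rule facet_if_card)
    have J: "cyc_indep 7 J" "card J = 3" using that unfolding cyc_indep_def by auto
    then show "?h ` J \<in> \<Delta>" using indep_pt[OF r, of J k] m unfolding cyc_indep_def by simp
    show "card (?h ` J) = m div 2" using card_pt_image[OF r, of J k] J m unfolding cyc_indep_def by simp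
  qed
  have main: False if ij: "j < i" "i < length Fs"
    and J: "{I, J} = {{0, 2, 4}, {0, 3, 5}}" and F: "Fs ! i = ?h ` I" "Fs ! j = ?h ` J" for i j I J
  proof -
    have IJ: "I = {0, 2, 4} \<and> J = {0, 3, 5} \<or> I = {0, 3, 5} \<and> J = {0, 2, 4}"
      using J by (simp add: doubleton_eq_iff)
    then have h0: "?h 0 \<in> Fs ! i" "?h 0 \<in> Fs ! j" using F by auto
    obtain x q where x: "x \<in> Fs ! i - Fs ! j" "q < i" "Fs ! i - Fs ! q = {x}" using shell[OF ij(2,1)] by blast
    \<comment> \<open>As \<open>x\<close> lies outside \<open>Fs ! j\<close>, it is not the common
      vertex, which therefore stays in \<open>Fs ! q\<close>. Being neither the last facet nor
      \<open>Fs ! i\<close>, \<open>Fs ! q\<close> has to be \<open>Fs ! j\<close>, but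
      \<open>Fs ! i\<close> differs from that in two vertices.\<close>
    then have "pt r k \<in> Fs ! q" using h0 by auto
    moreover have q: "Fs ! q \<in> facets \<Delta>" using x(2) ij Fs by (metis less_trans nth_mem)
    ultimately obtain Q where Q: "Q \<in> {{0, 2, 4}, {0, 2, 5}, {0, 3, 5}}" "Fs ! q = ?h ` Q"
      using facet_7_through[OF m _ _ r] by metis
    have "Fs ! q \<noteq> Fs ! ?n" "Fs ! q \<noteq> Fs ! i"
      using x(2) ij dist by (auto simp: nth_eq_iff_index_eq)
    then have "Q \<noteq> {0, 2, 5}" "Q \<noteq> I" using Q(2) L F(1) by (fastforce, metis)
    then have "Q = J" using Q(1) IJ by auto
    then have "?h ` (I - J) = {x}"
      using x(3) Q F inj by (subst inj_on_image_set_diff[of ?h "{..<7}"]) (use IJ in \<open>auto simp: inj_on_def\<close>)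
    moreover have "card (?h ` (I - J)) = 2"
      using card_pt_image[OF r, of "I - J" k] IJ m by (auto simp: insert_Diff_if)
    ultimately show False by simp
  qed
  obtain a where a: "a < length Fs" "Fs ! a = ?h ` {0, 2, 4}" using fac Fs by (metis in_set_conv_nth)
  obtain b where b: "b < length Fs" "Fs ! b = ?h ` {0, 3, 5}" using fac Fs by (metis in_set_conv_nth)
  have "?h 2 \<notin> ?h ` {0, 3, 5}" using inj[of 2 0] inj[of 2 3] inj[of 2 5] by simp
  then have "a \<noteq> b" using a b by auto
  then show False using main[of a b "{0, 3, 5}" "{0, 2, 4}"] main[of b a "{0, 2, 4}" "{0, 3, 5}"] a b
    by (metis insert_commute linorder_neqE_nat)
qed

text \<open>Connectedness does not exclude this case, but purity of the deletion does. With
  \<open>x\<close> at coordinate 0, the facet \<open>{0, 2, 5}\<close> shrinks to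
  \<open>{2, 5}\<close>, which no other vertex extends, while \<open>{1, 3, 5}\<close> keeps its
  three elements.\<close>

lemma not_vd_7_cycle:
  assumes l: "l = 1" and m: "m = 7"
  shows "\<not> vertex_decomposable \<Delta>"
proof
  assume "vertex_decomposable \<Delta>"
  then show False
  proof cases
    case simplex
    then obtain W where "\<Delta> = Pow W" unfolding is_simplex_def by blast
    moreover have "{0} \<in> \<Delta>" "{1} \<in> \<Delta>" "{0, 1} \<notin> \<Delta>"
      using m unfolding face_iff_l_1[OF l] cyc_indep_def by auto
    ultimately show False by auto
  next
    case (shedding x)
    have D: "finite_complex (deletion \<Delta> {x})" by (rule finite_complex_deletion[OF finite_complex_\<Delta>])
    have pure: "pure (deletion \<Delta> {x})" by (rule vd_pure[OF shedding(4)])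
    have r: "0 < l" using l by simp
    let ?h = "\<lambda>i. pt 0 (x + i)"
    have x: "x = ?h 0" using face_less[OF shedding(2)] l m unfolding pt_def by simp
    have inj: "?h i = ?h j \<longleftrightarrow> i = j" if "i < 7" "j < 7" for i j
      using inj_on_eq_iff[OF inj_on_pt[OF r, of x], of i j] that m by simp
    have del: "?h ` J \<in> deletion \<Delta> {x}" if "cyc_indep 7 J" "0 \<notin> J" for J
    proof -
      have J: "J \<subseteq> {..<7}" using that unfolding cyc_indep_def by blast
      then have "?h ` J \<in> \<Delta>" using indep_pt[OF r, of J x] that m by simp
      moreover have "?h 0 \<notin> ?h ` J" using that(2) J inj[of 0] by auto
      ultimately show ?thesis using x unfolding deletion_def by simp
    qed
    have "?h ` {2, 5} \<in> facets (deletion \<Delta> {x})" unfolding facets_def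
    proof (intro CollectI conjI ballI impI)
      show "?h ` {2, 5} \<in> deletion \<Delta> {x}" by (rule del) (auto simp: cyc_indep_def)
      fix G assume G: "G \<in> deletion \<Delta> {x}" "?h ` {2, 5} \<subseteq> G"
      then have G\<Delta>: "G \<in> \<Delta>" "x \<notin> G" unfolding deletion_def by auto
      show "G = ?h ` {2, 5}"
      proof
        show "G \<subseteq> ?h ` {2, 5}"
        proof
          fix y assume y: "y \<in> G"
          then obtain i where i: "i < 7" "y = ?h i"
            using pt_surj_add[OF face_less[OF G\<Delta>(1) y], of 0 x] l m by auto
          have nadj: "\<not> adj (?h i) (?h 2)" "\<not> adj (?h i) (?h 5)"
            using G\<Delta>(1) y i G(2) unfolding \<Delta>_def indep_complex_def independent_def by auto
          have "i \<noteq> 0" using G\<Delta>(2) y i x by metis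
          moreover have "i \<in> {0, 1, 2, 3, 4, 5, 6}" using i(1) by auto
          moreover have "\<not> (Suc i mod m = 2 mod m \<or> Suc 2 mod m = i mod m)"
            "\<not> (Suc i mod m = 5 mod m \<or> Suc 5 mod m = i mod m)"
            using nadj unfolding adj_pt_add[OF r] .
          ultimately have "i \<in> {2, 5}" unfolding m by (elim insertE emptyE) simp_all
          then show "y \<in> ?h ` {2, 5}" using i(2) by blast
        qed
      qed (rule G(2))
    qed
    moreover have "card (?h ` {2, 5}) = 2" using card_pt_image[OF r, of "{2, 5}" x] m by simp
    moreover have "?h ` {1, 3, 5} \<in> deletion \<Delta> {x}" by (rule del) (auto simp: cyc_indep_def)
    moreover have "card (?h ` {1, 3, 5}) = 3" using card_pt_image[OF r, of "{1, 3, 5}" x] m by simp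
    ultimately show False using pure_facet_card[OF D pure] by fastforce
  qed
qed

text \<open>The common part of both characterizations: purity restricts \<open>m\<close>, and
  connectedness removes the square and the joins, so that only the 7-cycle has to be excluded
  separately.\<close>

lemma vd_shellable_cases:
  assumes "pure \<Delta>" "\<And>F. F \<in> \<Delta> \<Longrightarrow> 2 \<le> card F \<Longrightarrow> complex_connected \<Delta>" "\<not> (l = 1 \<and> m = 7)"
  shows CM_parameters
proof -
  have m: "m \<in> {3, 4, 5, 7}" using assms(1) well_covered_iff unfolding \<Delta>_def pure_indep_complex by simp
  have "\<not> (m = 4 \<or> (2 \<le> l \<and> 4 \<le> m))"
  proof
    assume c: "m = 4 \<or> (2 \<le> l \<and> 4 \<le> m)"
    then have "complex_connected \<Delta>" using face_pair[of 0] assms(2) l_pos by force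
    then show False using not_connected_cases[OF c] by blast
  qed
  then show ?thesis using m assms(3) l_pos by auto
qed

lemma adj_complete:
  assumes "m = 3" "a < l * m" "b < l * m" "a \<noteq> b"
  shows "adj a b"
proof (cases "a mod l = b mod l")
  case True
  then have "a div l \<noteq> b div l" using assms(4) by (metis div_mult_mod_eq)
  moreover have "a div l < 3" "b div l < 3" using div_less_m assms by auto
  then have "a div l \<in> {0, 1, 2}" "b div l \<in> {0, 1, 2}" by auto
  ultimately have "Suc (a div l) mod 3 = b div l \<or> Suc (b div l) mod 3 = a div l"
    by (elim insertE emptyE) simp_all
  then show ?thesis using assms unfolding adj_def by simp
next
  case False
  then show ?thesis using assms(2,3) unfolding adj_def by simp
qed

lemma vd_iff: "vertex_decomposable \<Delta> \<longleftrightarrow> CM_parameters"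
proof
  assume vd: "vertex_decomposable \<Delta>"
  show CM_parameters
    by (rule vd_shellable_cases[OF vd_pure[OF vd]])
      (use vd_connected[OF vd finite_complex_\<Delta>] not_vd_7_cycle vd in blast)+
next
  assume p: CM_parameters
  show "vertex_decomposable \<Delta>"
  proof (cases "m = 3")
    case True
    show ?thesis unfolding \<Delta>_def
      by (rule vd_indep_complex_complete[OF _ _ symp_adj irreflp_adj])
        (use adj_complete[OF True] l_pos m_ge_3 in \<open>auto simp: lessThan_empty_iff\<close>)
  qed (use vd_5_cycle p in blast)
qed

lemma shellable_iff: "shellable \<Delta> \<longleftrightarrow> CM_parameters"
proof
  assume sh: "shellable \<Delta>"
  then have "pure \<Delta>" unfolding shellable_def by blast
  then show CM_parameters
    by (rule vd_shellable_cases)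
      (use shellable_connected[OF sh finite_complex_\<Delta>] not_shellable_7_cycle sh in blast)+
next
  assume p: CM_parameters
  show "shellable \<Delta>"
  proof (cases "m = 3")
    case True
    show ?thesis unfolding \<Delta>_def
      by (rule shellable_indep_complex_complete[OF _ _ irreflp_adj])
        (use adj_complete[OF True] l_pos m_ge_3 in \<open>auto simp: lessThan_empty_iff\<close>)
  qed (use shellable_5_cycle p in blast)
qed

section \<open>The induced matching number\<close>

lemma induced_matchingE:
  assumes "induced_matching V E M" "e \<in> M"
  obtains a b where "e = {a, b}" "a \<in> V" "b \<in> V" "E a b"
  using bspec[OF conjunct1[OF assms(1)[unfolded induced_matching_def]] assms(2)] by (elim exE conjE)

lemma induced_matching_disjoint:
  assumes "induced_matching V E M" "e \<in> M" "e' \<in> M" "e \<noteq> e'"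
  shows "e \<inter> e' = {}" "a \<in> e \<Longrightarrow> b \<in> e' \<Longrightarrow> \<not> E a b"
  using conjunct2[OF assms(1)[unfolded induced_matching_def], rule_format, OF assms(2-4)] by simp_all

text \<open>A lone edge may join two copies. Given a second edge, each vertex of one is nonadjacent
  to each vertex of the other and so lies in the same copy, which pins down both ends of every
  edge.\<close>

lemma induced_matching_one_copy:
  assumes M: "induced_matching {..<l * m} adj M" and e: "e0 \<in> M" "e1 \<in> M" "e0 \<noteq> e1"
  obtains r where "r < l" "\<And>e a. e \<in> M \<Longrightarrow> a \<in> e \<Longrightarrow> a mod l = r"
proof -
  have range: "a < l * m" if e: "e \<in> M" and a: "a \<in> e" for a e
  proof -
    obtain u v where "e = {u, v}" "u \<in> {..<l * m}" "v \<in> {..<l * m}"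
      by (rule induced_matchingE[OF M e])
    then show ?thesis using a by auto
  qed
  have same: "a mod l = b mod l" if "e \<in> M" "e' \<in> M" "e \<noteq> e'" "a \<in> e" "b \<in> e'" for e e' a b
  proof -
    have "\<not> adj a b" by (rule induced_matching_disjoint(2)[OF M that])
    then show ?thesis using range[OF that(1,4)] range[OF that(2,5)] unfolding adj_def by metis
  qed
  have "e \<noteq> {}" if "e \<in> M" for e by (rule induced_matchingE[OF M that]) simp
  with e(1,2) obtain a0 b0 where ab: "a0 \<in> e0" "b0 \<in> e1" by blast
  have "a mod l = a0 mod l" if "e \<in> M" "a \<in> e" for e a
  proof (cases "e = e0")
    case True
    then have "a mod l = b0 mod l" using same[OF that(1) e(2) _ that(2) ab(2)] e(3) by simp
    also have "\<dots> = a0 mod l" using same[OF e(2,1) _ ab(2,1)] e(3) by simp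
    finally show ?thesis .
  next
    case False
    then show ?thesis using same[OF that(1) e(1) _ that(2) ab(1)] by simp
  qed
  moreover have "a0 mod l < l" using l_pos by simp
  ultimately show ?thesis using that by blast
qed

text \<open>Enlarging each edge of an induced matching of a cycle by the next vertex
  keeps the edges disjoint.\<close>

lemma induced_matching_card_le:
  assumes M: "induced_matching {..<l * m} adj M"
  shows "card M \<le> m div 3"
proof (cases "\<exists>e0\<in>M. \<exists>e1\<in>M. e0 \<noteq> e1")
  case False
  \<comment> \<open>A single edge may run between two copies, where the argument on one cycle does
    not apply; \<open>1 \<le> m div 3\<close> settles this case.\<close>
  then have "M \<subseteq> {e}" if "e \<in> M" for e using that by blast
  then have "card M \<le> 1" using card_mono[of "{_}" M] by (cases "M = {}") force+
  then show ?thesis using m_ge_3 by simp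
next
  case True
  then obtain e0 e1 where "e0 \<in> M" "e1 \<in> M" "e0 \<noteq> e1" by blast
  from induced_matching_one_copy[OF M this]
  obtain r where r: "r < l" "\<And>e a. e \<in> M \<Longrightarrow> a \<in> e \<Longrightarrow> a mod l = r" by blast
  have "\<exists>y. e = {pt r y, pt r (Suc y)}" if e: "e \<in> M" for e
  proof -
    have next_pt: "pt r (Suc (a div l)) = b" if "Suc (a div l) mod m = b div l" "b < l * m" "b mod l = r" for a b
      using that(1) unfolding pt_def that(3)[symmetric] by (simp add: div_mult_mod_eq)
    obtain a b where ab: "e = {a, b}" "a < l * m" "b < l * m" "adj a b"
      by (rule induced_matchingE[OF M e]) simp
    then have "a mod l = r" "b mod l = r" using r(2)[OF e] by auto
    moreover from this have "Suc (a div l) mod m = b div l \<or> Suc (b div l) mod m = a div l"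
      using ab(4) unfolding adj_def by simp
    moreover have "pt r (a div l) = a" "pt r (b div l) = b" using calculation pt_surj ab by metis+
    ultimately have "pt r (Suc (a div l)) = b \<or> pt r (Suc (b div l)) = a" using next_pt ab(2,3) by metis
    then show ?thesis
    proof
      assume "pt r (Suc (a div l)) = b"
      then show ?thesis using ab(1) \<open>pt r (a div l) = a\<close> by (intro exI[of _ "a div l"]) simp
    next
      assume "pt r (Suc (b div l)) = a"
      then show ?thesis using ab(1) \<open>pt r (b div l) = b\<close>
        by (intro exI[of _ "b div l"]) (simp add: insert_commute)
    qed
  qed
  then obtain f where f: "\<And>e. e \<in> M \<Longrightarrow> e = {pt r (f e), pt r (Suc (f e))}" by metis
  define T where "T e = (\<lambda>i. pt r (f e + i)) ` {..<3}" for e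
  have card_T: "card (T e) = 3" for e unfolding T_def using card_pt_image[OF r(1), of "{..<3}"] m_ge_3 by simp
  have mem: "pt r (f e + i) \<in> e" if "e \<in> M" "i < 2" for e i
  proof -
    have "pt r (f e + i) \<in> {pt r (f e), pt r (Suc (f e))}" using that(2) by (auto simp: less_2_cases_iff)
    then show ?thesis unfolding f[OF that(1), symmetric] .
  qed
  \<comment> \<open>The added vertex is adjacent to the second end of its edge, so it cannot belong
    to another edge of the matching.\<close>
  have succ: False if "e \<in> M" "e' \<in> M" "e \<noteq> e'" "j < 2" "pt r (f e + 2) = pt r (f e' + j)" for e e' j
  proof -
    have "\<not> adj (pt r (f e + 1)) (pt r (f e' + j))"
      by (rule induced_matching_disjoint(2)[OF M that(1-3)]) (use mem[OF that(1), of 1] mem[OF that(2,4)] in simp_all)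
    then show False unfolding that(5)[symmetric] by (simp add: adj_pt[OF r(1,1)])
  qed
  have disj: "T e \<inter> T e' = {}" if e: "e \<in> M" "e' \<in> M" "e \<noteq> e'" for e e'
  proof (rule ccontr)
    assume "T e \<inter> T e' \<noteq> {}"
    then obtain i j where ij: "i < 3" "j < 3" "pt r (f e + i) = pt r (f e' + j)" unfolding T_def by auto
    have d: "e \<inter> e' = {}" by (rule induced_matching_disjoint(1)[OF M e])
    consider "i < 2" "j < 2" | "i = 2" "j < 2" | "i < 2" "j = 2" | "i = 2" "j = 2" using ij by linarith
    then show False
    proof cases
      case 1
      then show False using mem[OF e(1)] mem[OF e(2)] ij(3) d by (metis disjoint_iff)
    next
      case 2
      show False by (rule succ[OF e 2(2)]) (use ij(3) 2(1) in simp)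
    next
      case 3
      show False by (rule succ[OF e(2,1) _ 3(1)]) (use ij(3) 3(2) e(3) in simp_all)
    next
      case 4
      then have "pt r (f e + 0) = pt r (f e' + 0)"
        using ij(3) mod_add_left_cancel_nat[of 2 "f e" m "f e'"] by (simp add: pt_eq_iff[OF r(1,1)])
      then show False using mem[OF e(1), of 0] mem[OF e(2), of 0] d by auto
    qed
  qed
  have "e \<subseteq> {..<l * m}" if "e \<in> M" for e using f[OF that] pt_less[OF r(1)] by (metis insert_subset empty_subsetI lessThan_iff)
  then have "M \<subseteq> Pow {..<l * m}" by blast
  then have fin: "finite M" using finite_subset by blast
  have "3 * card M = card (\<Union>e\<in>M. T e)"
    using card_UN_disjoint[OF fin, of T] disj card_T by (simp add: T_def)
  also have "\<dots> \<le> card (pt r ` {..<m})"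
  proof (rule card_mono)
    have "pt r i \<in> pt r ` {..<m}" for i
      by (rule image_eqI[of _ _ "i mod m"]) (use m_ge_3 in \<open>simp_all add: pt_def\<close>)
    then show "(\<Union>e\<in>M. T e) \<subseteq> pt r ` {..<m}" unfolding T_def by blast
  qed simp
  also have "\<dots> \<le> m" using card_image_le[of "{..<m}" "pt r"] by simp
  finally show ?thesis by simp
qed

text \<open>The extremal matching lies in copy 0 and leaves out every third vertex as a separator.
  Its last edge ends at \<open>m - 2\<close> or earlier, so no adjacency arises around the end of
  the cycle.\<close>

lemma induced_matching_number: "induced_matching_number {..<l * m} adj = m div 3"
proof -
  have l: "0 < l" using l_pos by simp
  let ?e = "\<lambda>i. {pt 0 (3 * i), pt 0 (Suc (3 * i))}"
  let ?M = "?e ` {..<m div 3}"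
  have lt: "Suc (3 * i) < m" if "i < m div 3" for i using that by linarith
  have eq: "pt 0 a = pt 0 b \<longleftrightarrow> a = b" if "a < m" "b < m" for a b using that pt_eq_iff[OF l l] by simp
  have adj: "adj (pt 0 a) (pt 0 b) \<longleftrightarrow> Suc a = b \<or> Suc b = a" if "Suc a < m" "Suc b < m" for a b
    using that by (simp add: adj_pt[OF l l])
  have adj_succ: "adj (pt 0 a) (pt 0 (Suc a))" for a by (simp add: adj_pt[OF l l])
  have cross: "a \<noteq> b \<and> \<not> adj a b" if ij: "i < m div 3" "j < m div 3" "i \<noteq> j" "a \<in> ?e i" "b \<in> ?e j" for i j a b
  proof -
    obtain s t where st: "s \<le> 1" "t \<le> 1" "a = pt 0 (3 * i + s)" "b = pt 0 (3 * j + t)"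
      using ij(4,5) by (metis Suc_eq_plus1 add_0_right insertE le_numeral_extra(4) singletonD zero_le)
    have "Suc (3 * i + s) < m" "Suc (3 * j + t) < m" using st ij(1,2) by linarith+
    then show ?thesis unfolding st(3,4) using adj eq[of "3 * i + s" "3 * j + t"] ij(3) st(1,2) by (auto; presburger)
  qed
  have M: "induced_matching {..<l * m} adj ?M" unfolding induced_matching_def
  proof (intro conjI ballI impI)
    fix e assume "e \<in> ?M"
    then obtain i where i: "i < m div 3" "e = ?e i" by auto
    then show "\<exists>a b. e = {a, b} \<and> a \<noteq> b \<and> a \<in> {..<l * m} \<and> b \<in> {..<l * m} \<and> adj a b"
      using lt[OF i(1)] eq[of "3 * i" "Suc (3 * i)"] pt_less[OF l] adj_succ
      by (intro exI[of _ "pt 0 (3 * i)"] exI[of _ "pt 0 (Suc (3 * i))"]) simp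
  next
    fix e e' assume "e \<in> ?M" "e' \<in> ?M" and ne: "e \<noteq> e'"
    then obtain i j where ij: "i < m div 3" "j < m div 3" "e = ?e i" "e' = ?e j" by auto
    then have "i \<noteq> j" using ne by blast
    then show "e \<inter> e' = {}" using cross[OF ij(1,2)] ij by blast
    fix a b assume "a \<in> e" "b \<in> e'"
    then show "\<not> adj a b" using cross[OF ij(1,2) \<open>i \<noteq> j\<close>] ij by blast
  qed
  have "inj_on ?e {..<m div 3}" by (rule inj_onI) (use cross in \<open>metis insertI1 lessThan_iff\<close>)
  then have card: "card ?M = m div 3" by (simp add: card_image)
  have "finite {card M |M. induced_matching {..<l * m} adj M}"
    by (rule finite_subset[of _ "{..m div 3}"]) (use induced_matching_card_le in auto)
  moreover have "m div 3 \<in> {card M |M. induced_matching {..<l * m} adj M}"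
    using M card[symmetric] by blast
  ultimately show ?thesis unfolding induced_matching_number_def
    using induced_matching_card_le by (intro Max_eqI) auto
qed

end

section \<open>Identification with the circulant graph\<close>

lemma circ_dist_commute: "circ_dist n a b = circ_dist n b a"
  unfolding circ_dist_def Let_def by auto

text \<open>Two vertices lie in the same copy exactly when \<open>l\<close> divides their difference
  \<open>d\<close>. Then \<open>d = l * q\<close> gives the distance
  \<open>l * min q (m - q)\<close>, and as \<open>l\<close> is the only multiple of \<open>l\<close>
  in the connection set, adjacency means \<open>q = 1\<close> or \<open>q = m - 1\<close>. Otherwise
  \<open>l\<close> divides neither \<open>d\<close> nor \<open>l * m - d\<close>, and the distance
  always belongs to the set.\<close>

lemma (in cycle_join) circ_adj_eq_adj:
  "circ_adj (l * m) {s \<in> {1..(l * m) div 2}. s = l \<or> \<not> l dvd s} = adj"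
proof -
  let ?S = "{s \<in> {1..(l * m) div 2}. s = l \<or> \<not> l dvd s}"
  have *: "circ_dist (l * m) a b \<in> ?S \<longleftrightarrow> adj a b" if ab: "b \<le> a" "a < l * m" for a b
  proof -
    define d where "d = a - b"
    have dist: "circ_dist (l * m) a b = min d (l * m - d)" using ab unfolding circ_dist_def d_def by simp
    have d: "d < l * m" using ab unfolding d_def by simp
    have b: "b < l * m" using ab by simp
    have l: "0 < l" using l_pos by simp
    have cong: "a mod l = b mod l \<longleftrightarrow> l dvd d" unfolding d_def using mod_eq_dvd_iff_nat[OF ab(1)] .
    show ?thesis
    proof (cases "l dvd d")
      case True
      then obtain q where q: "d = l * q" by blast
      have "a = b + l * q" using q ab unfolding d_def by simp
      then have adiv: "a div l = b div l + q" using l by simp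
      have lt: "b div l + q < m" using div_less_m[OF ab(2)] adiv by simp
      have min: "min d (l * m - d) = l * min q (m - q)"
        using lt unfolding q by (simp add: min_def diff_mult_distrib2[symmetric])
      \<comment> \<open>This puts \<open>l\<close> itself within the range of the connection
        set.\<close>
      have "2 * l \<le> l * m" using m_ge_3 by simp
      then have "l \<le> (l * m) div 2" by linarith
      then have "circ_dist (l * m) a b \<in> ?S \<longleftrightarrow> min q (m - q) = 1" unfolding dist min using l by auto
      also have "\<dots> \<longleftrightarrow> q = 1 \<or> q + 1 = m" using lt m_ge_3 by (auto simp: min_def)
      also have "\<dots> \<longleftrightarrow> Suc (a div l) mod m = b div l \<or> Suc (b div l) mod m = a div l"
        unfolding adiv using lt m_ge_3 by (auto simp: Suc_mod_cases)
      also have "\<dots> \<longleftrightarrow> adj a b" using ab b True cong unfolding adj_def by simp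
      finally show ?thesis .
    next
      case False
      then have "d \<noteq> 0" by (metis dvd_0_right)
      moreover have "\<not> l dvd l * m - d" using False d by (metis dvd_diff_nat dvd_triv_left diff_diff_cancel less_imp_le)
      ultimately have "circ_dist (l * m) a b \<in> ?S" unfolding dist using False d by (auto simp: min_def)
      moreover have "adj a b" using ab b False cong unfolding adj_def by simp
      ultimately show ?thesis by blast
    qed
  qed
  show ?thesis
  proof (intro ext)
    fix a b
    show "circ_adj (l * m) ?S a b = adj a b"
    proof (cases "a < l * m \<and> b < l * m")
      case True
      then show ?thesis unfolding circ_adj_def
        using *[of b a] *[of a b] circ_dist_commute[of "l * m" a b] sympD[OF symp_adj, of a b] sympD[OF symp_adj, of b a]
        by (cases "b \<le> a") auto
    qed (auto simp: circ_adj_def adj_def)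
  qed
qed

theorem theorem4p7:
  fixes l m :: nat and K :: "'k::field itself"
  assumes "l \<ge> 1" and "m \<ge> 3"
  defines "S \<equiv> {s \<in> {1..(l * m) div 2}. s = l \<or> \<not> l dvd s}"
  defines "V \<equiv> circ_vertices (l * m)" and "E \<equiv> circ_adj (l * m) S"
  shows "induced_matching_number V E = m div 3
    \<and> (well_covered V E \<longleftrightarrow> m \<in> {3, 4, 5, 7})
    \<and> (graph_Buchsbaum K V E \<longleftrightarrow> m \<in> {3, 4, 5, 7})
    \<and> (graph_vd V E \<longleftrightarrow> (l = 1 \<and> m \<in> {3, 5}) \<or> (l \<ge> 2 \<and> m = 3))
    \<and> (graph_shellable V E \<longleftrightarrow> (l = 1 \<and> m \<in> {3, 5}) \<or> (l \<ge> 2 \<and> m = 3))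
    \<and> (graph_CM K V E \<longleftrightarrow> (l = 1 \<and> m \<in> {3, 5}) \<or> (l \<ge> 2 \<and> m = 3))
    \<and> (graph_SCM K V E \<longleftrightarrow> (l = 1 \<and> m \<in> {3, 5}) \<or> (l \<ge> 2 \<and> m = 3))
    \<and> (graph_S2 V E \<longleftrightarrow> (l = 1 \<and> m \<in> {3, 5, 7}) \<or> (l \<ge> 2 \<and> m = 3))"
proof -
  interpret cycle_join l m by unfold_locales (use assms in auto)
  have V: "V = {..<l * m}" unfolding V_def circ_vertices_def by auto
  have E: "E = adj" unfolding E_def S_def by (rule circ_adj_eq_adj)
  show ?thesis
    unfolding V E graph_vd_def graph_shellable_def graph_CM_def graph_SCM_def graph_S2_def
      \<Delta>_def[symmetric] induced_matching_number well_covered_iff Buchsbaum_iff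
      vd_iff shellable_iff CM_iff SCM_iff S2_iff
    by simp
qed

end
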